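(* Let $P\in\mathrm{Op}_{\hbar\mathbb{Z}^n}S^m(\hbar\mathbb{Z}^n\times\mathbb{T}^n)$ be a semi-classical pseudo-differential operator with symbol $\sigma_{\hbar,P}(k,\theta)\ge0$ for all $(k,\theta)\in\hbar\mathbb{Z}^n\times\mathbb{T}^n$. Then there exists $C<\infty$ such that $$\mathrm{Re}\,(Pg,g)_{\ell^2(\hbar\mathbb{Z}^n)}\ge-C\|g\|_{\ell^2_{\frac{m-1}2}(\hbar\mathbb{Z}^n)}$$ for all $g\in\ell^2_{\frac{m-1}2}(\hbar\mathbb{Z}^n)$.
   Context: Fix $n\ge1$, $\hbar\in(0,1]$ and $m\in\mathbb{R}$. $\hbar\mathbb{Z}^n=\{\hbar\bar k:\bar k\in\mathbb{Z}^n\}\subset\mathbb{R}^n$, $|k|$ is the Euclidean norm, $\mathbb{T}^n=\mathbb{R}^n/\mathbb{Z}^n$, $k\cdot\theta=\sum_jk_j\theta_j$. Semi-classical Fourier transform: $\widehat f(\theta)=\sum_{k\in\hbar\mathbb{Z}^n}e^{-2\pi\frac{i}{\hbar}k\cdot\theta}f(k)$. Quantization: $\mathrm{Op}_{\hbar\mathbb{Z}^n}(\sigma_\hbar)f(k)=\int_{\mathbb{T}^n}e^{2\pi\frac{i}{\hbar}k\cdot\theta}\sigma_\hbar(k,\theta)\widehat f(\theta)\,d\theta$; $\mathrm{Op}_{\hbar\mathbb{Z}^n}S^m$ is the set of such operators with $\sigma_\hbar\in S^m$, and $\sigma_{\hbar,P}$ denotes the symbol of $P$. Difference operators: with $v_j$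 the $j$-th standard unit vector, $\Delta_{\hbar,j}g(k)=\frac{g(k+\hbar v_j)-g(k)}{\hbar}$, $\Delta_\hbar^\alpha=\Delta_{\hbar,1}^{\alpha_1}\cdots\Delta_{\hbar,n}^{\alpha_n}$ (written $\Delta^\alpha_{\hbar,k}$ when acting in $k$). Toroidal operators: $D_{\hbar,\theta}^{(\beta)}=\hbar^{|\beta|}\prod_{j=1}^n\prod_{\ell=0}^{\beta_j-1}\big(\frac{1}{2\pi i}\frac{\partial}{\partial\theta_j}-\ell\big)$. $S^m(\hbar\mathbb{Z}^n\times\mathbb{T}^n)=S^m_{1,0}(\hbar\mathbb{Z}^n\times\mathbb{T}^n)$ is the set of $\sigma_\hbar:\hbar\mathbb{Z}^n\times\mathbb{T}^n\to\mathbb{C}$ with $\sigma_\hbar(k,\cdot)\in C^\infty(\mathbb{T}^n)$ for all $k$, such that for all multi-indices $\alpha,\beta$ there is $C_{\alpha,\beta}>0$ with $|D^{(\beta)}_{\hbar,\theta}\Delta^\alpha_{\hbar,k}\sigma_\hbar(k,\theta)|\le C_{\alpha,\beta}(1+|k|)^{m-|\alpha|}$ for all $(k,\theta)$. Weighted space: for $s\in\mathbb{R}$, $\ell^2_s(\hbar\mathbb{Z}^n)$ is the space of $f:\hbar\mathbb{Z}^n\to\mathbb{C}$ with $\|f\|_{\ell^2_s(\hbar\mathbb{Z}^n)}=\big(\sum_{k\in\hbar\mathbb{Z}^n}(1+|k|)^{2s}|f(k)|^2\big)^{1/2}<\infty$. The inner product is $(f,g)_{\ell^2(\hbar\mathb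b{Z}^n)}=\sum_{k\in\hbar\mathbb{Z}^n}f(k)\overline{g(k)}$.
   Formalization: The norm on the right is squared, since with the first power the inequality fails when g is replaced by tg, t→∞ (e.g. symbol 1_{k=0}(1+cos 2πθ)); for g whose series (Pg,g) does not converge, the inequality carries no content. *)

theory Defs
  imports "HOL-Analysis.Analysis"
begin

text \<open>
  The letter \<open>h\<close> stands for the semi-classical parameter \<open>\<hbar>\<close>.
  Functions on the lattice \<open>\<hbar>\<int>\<^sup>n\<close> are represented by functions on \<^typ>\<open>real^'n\<close>; only their
  values on \<open>hlat h\<close> are ever used. Functions on the torus are \<open>\<int>\<^sup>n\<close>-periodic functions
  on \<^typ>\<open>real^'n\<close>, integrated over the unit cube.
\<close>

definition hlat :: "real \<Rightarrow> (real^'n) set" where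
  "hlat h = {h *\<^sub>R k | k. \<forall>i. k $ i \<in> \<int>}"

text \<open>
  An enumeration of the coordinates, used to write out the products of commuting operators that
  are indexed by the coordinates; on the functions considered, the order is immaterial.
\<close>

definition coords :: "'n::finite list" where
  "coords = (SOME js. distinct js \<and> set js = UNIV)"

definition mlen :: "('n::finite \<Rightarrow> nat) \<Rightarrow> nat" where
  "mlen \<alpha> = (\<Sum>j\<in>UNIV. \<alpha> j)"


subsection \<open>Difference operators\<close>

definition diff_op :: "real \<Rightarrow> 'n \<Rightarrow> (real^'n \<Rightarrow> complex) \<Rightarrow> real^'n \<Rightarrow> complex" where
  "diff_op h j g k = (g (k + h *\<^sub>R axis j 1) - g k) / of_real h"

definition diff_mop :: "real \<Rightarrow> ('n::finite \<Rightarrow> nat) \<Rightarrow> (real^'n \<Rightarrow> complex) \<Rightarrow> real^'n \<Rightarrow> complex" where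
  "diff_mop h \<alpha> = foldr (\<lambda>j. diff_op h j ^^ \<alpha> j) coords"


subsection \<open>Smooth functions on the torus and toroidal derivatives\<close>

definition pderiv_at :: "'n::finite \<Rightarrow> (real^'n \<Rightarrow> complex) \<Rightarrow> real^'n \<Rightarrow> complex" where
  "pderiv_at j u \<theta> = frechet_derivative u (at \<theta>) (axis j 1)"

fun Ck :: "nat \<Rightarrow> (real^'n::finite \<Rightarrow> complex) \<Rightarrow> bool" where
  "Ck 0 u \<longleftrightarrow> continuous_on UNIV u"
| "Ck (Suc r) u \<longleftrightarrow> (\<forall>\<theta>. u differentiable (at \<theta>)) \<and> (\<forall>j. Ck r (pderiv_at j u))"

definition torus_smooth :: "(real^'n::finite \<Rightarrow> complex) \<Rightarrow> bool" where
  "torus_smooth u \<longleftrightarrow> (\<forall>\<theta> j. u (\<theta> + axis j 1) = u \<theta>) \<and> (\<forall>r. Ck r u)"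

definition tor_factor :: "'n::finite \<Rightarrow> nat \<Rightarrow> (real^'n \<Rightarrow> complex) \<Rightarrow> real^'n \<Rightarrow> complex" where
  "tor_factor j l u \<theta> = 1 / (2 * of_real pi * \<i>) * pderiv_at j u \<theta> - of_nat l * u \<theta>"

definition tor_mop :: "real \<Rightarrow> ('n::finite \<Rightarrow> nat) \<Rightarrow> (real^'n \<Rightarrow> complex) \<Rightarrow> real^'n \<Rightarrow> complex" where
  "tor_mop h \<beta> u \<theta> =
     of_real h ^ mlen \<beta> * foldr (\<lambda>j. foldr (tor_factor j) [0..<\<beta> j]) coords u \<theta>"


subsection \<open>The symbol class \<open>S\<^sup>m\<close> and its quantization\<close>

definition symbol_class :: "real \<Rightarrow> real \<Rightarrow> (real^'n::finite \<Rightarrow> real^'n \<Rightarrow> complex) set" where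
  "symbol_class h m = {\<sigma>.
     (\<forall>k\<in>hlat h. torus_smooth (\<sigma> k)) \<and>
     (\<forall>\<alpha> \<beta>. \<exists>C>0. \<forall>k\<in>hlat h. \<forall>\<theta>.
        cmod (tor_mop h \<beta> (\<lambda>\<theta>'. diff_mop h \<alpha> (\<lambda>k'. \<sigma> k' \<theta>') k) \<theta>)
          \<le> C * (1 + norm k) powr (m - real (mlen \<alpha>)))}"

definition sc_fourier :: "real \<Rightarrow> (real^'n::finite \<Rightarrow> complex) \<Rightarrow> real^'n \<Rightarrow> complex" where
  "sc_fourier h f \<theta> = (\<Sum>\<^sub>\<infinity>k\<in>hlat h. exp (- 2 * of_real pi * \<i> / of_real h * of_real (k \<bullet> \<theta>)) * f k)"

definition sc_quant ::
    "real \<Rightarrow> (real^'n::finite \<Rightarrow> real^'n \<Rightarrow> complex) \<Rightarrow> (real^'n \<Rightarrow> complex) \<Rightarrow> real^'n \<Rightarrow> complex" where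
  "sc_quant h \<sigma> f k = integral (cbox 0 1)
     (\<lambda>\<theta>. exp (2 * of_real pi * \<i> / of_real h * of_real (k \<bullet> \<theta>)) * \<sigma> k \<theta> * sc_fourier h f \<theta>)"

text \<open>
  For \<open>f\<close> in a weighted space \<open>\<ell>\<^sup>2\<^sub>s\<close>, the Fourier transform of \<open>f\<close> is in general only a periodic
  distribution, so the integral in \<open>sc_quant\<close> is a distributional pairing with a smooth function.
  That pairing is the limit of the literal integrals for the restrictions of \<open>f\<close> to finite subsets
  of the lattice. If \<open>f\<close> is absolutely summable, it is the literal integral (lemma
  \<open>sc_Op_eq_sc_quant\<close>).
\<close>

definition sc_Op ::
    "real \<Rightarrow> (real^'n::finite \<Rightarrow> real^'n \<Rightarrow> complex) \<Rightarrow> (real^'n \<Rightarrow> complex) \<Rightarrow> real^'n \<Rightarrow> complex" where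
  "sc_Op h \<sigma> f k =
     Lim (finite_subsets_at_top (hlat h)) (\<lambda>F. sc_quant h \<sigma> (\<lambda>j. if j \<in> F then f j else 0) k)"

lemma sc_Op_eq_sc_quant:
  fixes \<sigma> :: "real^'n::finite \<Rightarrow> real^'n \<Rightarrow> complex"
  assumes f: "(\<lambda>j. cmod (f j)) summable_on hlat h"
    and cont: "continuous_on (cbox 0 1) (\<sigma> k)"
  shows "sc_Op h \<sigma> f k = sc_quant h \<sigma> f k"
proof -
  let ?B = "cbox 0 1 :: (real^'n) set" and ?L = "hlat h :: (real^'n) set"
  define e where "e = (\<lambda>j \<theta> :: real^'n. exp (- 2 * of_real pi * \<i> / of_real h * of_real (j \<bullet> \<theta>)))"
  define \<phi> where "\<phi> = (\<lambda>\<theta>. exp (2 * of_real pi * \<i> / of_real h * of_real (k \<bullet> \<theta>)) * \<sigma> k \<theta>)"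
  define S where "S = (\<lambda>F \<theta>. \<Sum>j\<in>F. e j \<theta> * f j)"
  have norm_e: "cmod (e j \<theta>) = 1" for j \<theta>
    by (simp add: e_def)
  have quant: "sc_quant h \<sigma> g k = integral ?B (\<lambda>\<theta>. \<phi> \<theta> * sc_fourier h g \<theta>)" for g
    by (simp add: sc_quant_def \<phi>_def)
  have trunc: "sc_fourier h (\<lambda>j. if j \<in> F then f j else 0) = S F"
    if "finite F" "F \<subseteq> ?L" for F
  proof
    fix \<theta>
    have "(\<Sum>\<^sub>\<infinity>j\<in>?L. e j \<theta> * (if j \<in> F then f j else 0)) = (\<Sum>\<^sub>\<infinity>j\<in>F. e j \<theta> * f j)"
      using that by (intro infsum_cong_neutral) auto
    then show "sc_fourier h (\<lambda>j. if j \<in> F then f j else 0) \<theta> = S F \<theta>"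
      using that by (simp add: sc_fourier_def e_def S_def)
  qed
  have "uniform_limit ?B S (\<lambda>\<theta>. \<Sum>\<^sub>\<infinity>j\<in>?L. e j \<theta> * f j) (finite_subsets_at_top ?L)"
    unfolding S_def
    by (rule Weierstrass_m_test_general[OF _ f]) (simp add: norm_mult norm_e)
  then have ulS: "uniform_limit ?B S (sc_fourier h f) (finite_subsets_at_top ?L)"
    by (simp add: sc_fourier_def [abs_def] e_def)
  have cont_phi: "continuous_on ?B \<phi>"
    unfolding \<phi>_def by (intro continuous_intros cont)
  have cont_S: "continuous_on ?B (S F)" for F
    unfolding S_def e_def by (intro continuous_intros)
  have cont_f: "continuous_on ?B (sc_fourier h f)"
    by (rule uniform_limit_theorem[OF _ ulS]) (auto simp: cont_S)
  have "uniform_limit ?B (\<lambda>F \<theta>. \<phi> \<theta> * S F \<theta>) (\<lambda>\<theta>. \<phi> \<theta> * sc_fourier h f \<theta>) (finite_subsets_at_top ?L)"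
    by (intro uniform_lim_mult ulS uniform_limit_const compact_imp_bounded compact_continuous_image
          cont_phi cont_f compact_cbox)
  then obtain I J where IJ: "\<And>F. ((\<lambda>\<theta>. \<phi> \<theta> * S F \<theta>) has_integral I F) ?B"
      "((\<lambda>\<theta>. \<phi> \<theta> * sc_fourier h f \<theta>) has_integral J) ?B" "(I \<longlongrightarrow> J) (finite_subsets_at_top ?L)"
    by (rule uniform_limit_integral_cbox) (auto intro!: continuous_intros cont_phi cont_S)
  have "((\<lambda>F. integral ?B (\<lambda>\<theta>. \<phi> \<theta> * S F \<theta>)) \<longlongrightarrow> integral ?B (\<lambda>\<theta>. \<phi> \<theta> * sc_fourier h f \<theta>))
      (finite_subsets_at_top ?L)"
    unfolding integral_unique[OF IJ(1)] integral_unique[OF IJ(2)] by (fact IJ(3))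
  then have "((\<lambda>F. sc_quant h \<sigma> (\<lambda>j. if j \<in> F then f j else 0) k) \<longlongrightarrow> sc_quant h \<sigma> f k)
      (finite_subsets_at_top ?L)"
    unfolding quant
    by (rule Lim_transform_eventually)
       (auto intro!: eventually_finite_subsets_at_top_weakI simp: trunc)
  then show ?thesis
    unfolding sc_Op_def by (intro tendsto_Lim) auto
qed


subsection \<open>Weighted spaces and the inner product\<close>

definition l2w :: "real \<Rightarrow> real \<Rightarrow> (real^'n::finite \<Rightarrow> complex) set" where
  "l2w h s = {f. (\<lambda>k. (1 + norm k) powr (2 * s) * (cmod (f k))\<^sup>2) summable_on hlat h}"

definition l2w_norm :: "real \<Rightarrow> real \<Rightarrow> (real^'n::finite \<Rightarrow> complex) \<Rightarrow> real" where
  "l2w_norm h s f = sqrt (\<Sum>\<^sub>\<infinity>k\<in>hlat h. (1 + norm k) powr (2 * s) * (cmod (f k))\<^sup>2)"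

text \<open>
  If the series does not converge unconditionally, the library's infinite sum is \<open>0\<close>. For
  \<open>g\<close> in \<open>\<ell>\<^sup>2\<^sub>s\<close> with \<open>s = (m - 1) / 2\<close>, the series of \<open>(P g, g)\<close> need not converge (it does for
  \<open>g\<close> in \<open>\<ell>\<^sup>2\<^sub>m\<^sub>/\<^sub>2\<close>), so a lower bound for it has content exactly for those \<open>g\<close> for which it converges.
\<close>

definition l2_inner :: "real \<Rightarrow> (real^'n::finite \<Rightarrow> complex) \<Rightarrow> (real^'n \<Rightarrow> complex) \<Rightarrow> complex" where
  "l2_inner h f g = (\<Sum>\<^sub>\<infinity>k\<in>hlat h. f k * cnj (g k))"

end

theory Submission
  imports Defs
begin

text \<open>
  The operator \<open>P\<close> has the kernel \<open>K(a,b) = s(a, b - a)\<close>, where \<open>s(k,l)\<close> is the Fourier coefficient of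
  \<open>\<sigma>(k,\<cdot>)\<close> at \<open>l\<close>; it decays rapidly in \<open>l\<close>, and each difference in \<open>k\<close> gains a power of \<open>1 + |k|\<close>.
  Friedrichs' symmetrization replaces \<open>K\<close> by \<open>Q(a,b) = \<Sum>\<xi>. \<phi>\<^sub>a(\<xi>) \<phi>\<^sub>b(\<xi>) s(\<xi>, b - a)\<close>, where \<open>\<phi>\<^sub>a\<close> is an
  \<open>\<ell>\<^sup>2\<close>-normalized even bump around \<open>a\<close> of width \<open>(1 + |a|)\<^sup>1\<^sup>/\<^sup>2\<close>. For fixed \<open>\<xi>\<close> the kernel \<open>s(\<xi>, b - a)\<close> is
  the Fourier multiplier with the nonnegative symbol \<open>\<sigma>(\<xi>,\<cdot>)\<close>, so \<open>Q\<close> is positive. By a second-order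
  Taylor expansion, \<open>K - Q\<close> is of order \<open>m - 1\<close>, and Schur's test bounds its quadratic form. Since
  \<open>g\<close> need not lie in the form domain of \<open>P\<close>, the estimate is applied to \<open>\<chi>\<^sub>R g\<close> with \<open>\<chi>\<^sub>R(a) = max(0, 1 - |a|/R)\<close>:
  the commutators of \<open>P\<close> with \<open>\<chi>\<^sub>R\<close> are of order \<open>m - 1\<close> uniformly in \<open>R\<close>, and \<open>R\<close> tends to infinity.
\<close>

subsection \<open>Lattice sums and Schur's test\<close>

text \<open>Only differences in k lower the order in this symbol class; torus derivatives leave it
  unchanged. The localization is therefore in k alone, and \<theta> is integrated out exactly. All
  estimates are made on kernels and not on symbols: rapid decay in b - a absorbs every power of 1 +
  |b - a|, so weights and bump widths at a and at b may be exchanged freely. The parameter h is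
  fixed and the final constant may depend on it, hence powers of 1/h from differences and point
  counts do no harm. Since K - Q is bounded in absolute value, its lack of Hermitian symmetry does
  not matter: its real part is at least minus its modulus. The double series over (a,b) need not
  converge absolutely for the given g, although each row does; this forces the cutoff. The cutoff
  has to be Lipschitz at scale R: an indicator function jumps between neighbouring points near |a| =
  R, where its commutator with P would in general keep the order m.\<close>

lemma mem_hlat_iff: "l \<in> hlat h \<longleftrightarrow> (\<forall>i. l $ i \<in> range (\<lambda>z. h * real_of_int z))"
proof
  assume "l \<in> hlat h"
  then obtain k where "l = h *\<^sub>R k" "\<forall>i. k $ i \<in> \<int>" by (auto simp: hlat_def)
  then show "\<forall>i. l $ i \<in> range (\<lambda>z. h * real_of_int z)"
    by (metis Ints_cases rangeI vector_scaleR_component real_scaleR_def)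
next
  assume *: "\<forall>i. l $ i \<in> range (\<lambda>z. h * real_of_int z)"
  then have "\<forall>i. \<exists>z. l $ i = h * real_of_int z" by blast
  then obtain z where "\<And>i. l $ i = h * real_of_int (z i)" by metis
  then have "l = h *\<^sub>R (\<chi> i. real_of_int (z i))" by (simp add: vec_eq_iff)
  then show "l \<in> hlat h" unfolding hlat_def by fastforce
qed

lemma hlat_add: "a \<in> hlat h \<Longrightarrow> b \<in> hlat h \<Longrightarrow> a + b \<in> hlat h"
  unfolding mem_hlat_iff
proof
  fix i
  assume "\<forall>i. a $ i \<in> range (\<lambda>z. h * real_of_int z)" "\<forall>i. b $ i \<in> range (\<lambda>z. h * real_of_int z)"
  then obtain y z where "a $ i = h * real_of_int y" "b $ i = h * real_of_int z" by blast
  then have "(a + b) $ i = h * real_of_int (y + z)" by (simp add: distrib_left)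
  then show "(a + b) $ i \<in> range (\<lambda>z. h * real_of_int z)" by blast
qed

lemma hlat_minus: "a \<in> hlat h \<Longrightarrow> - a \<in> hlat h"
  unfolding mem_hlat_iff
proof
  fix i
  assume "\<forall>i. a $ i \<in> range (\<lambda>z. h * real_of_int z)"
  then obtain z where "a $ i = h * real_of_int z" by blast
  then have "(- a) $ i = h * real_of_int (- z)" by simp
  then show "(- a) $ i \<in> range (\<lambda>z. h * real_of_int z)" by blast
qed

lemma hlat_diff: "a \<in> hlat h \<Longrightarrow> b \<in> hlat h \<Longrightarrow> a - b \<in> hlat h"
  using hlat_add[of a h "- b"] hlat_minus[of b h] by simp

lemma hlat_axis: "h *\<^sub>R axis j 1 \<in> hlat h"
  unfolding hlat_def by (auto simp: axis_def)

section \<open>Lattice points in cubes\<close>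

lemma infnorm_le_iff: "infnorm (x::real^'n::finite) \<le> r \<longleftrightarrow> (\<forall>i. \<bar>x $ i\<bar> \<le> r)"
proof
  assume "\<forall>i. \<bar>x $ i\<bar> \<le> r"
  then show "infnorm x \<le> r"
    unfolding infnorm_cart by (intro cSup_least) auto
qed (use component_le_infnorm_cart order_trans in blast)

lemma norm_le_card_infnorm: "norm (x::real^'n::finite) \<le> real CARD('n) * infnorm x"
proof -
  have "norm x \<le> (\<Sum>i\<in>UNIV. \<bar>x $ i\<bar>)" by (rule norm_le_l1_cart)
  also have "\<dots> \<le> (\<Sum>i\<in>(UNIV::'n set). infnorm x)"
    by (intro sum_mono component_le_infnorm_cart)
  finally show ?thesis by simp
qed

lemma vec_box_eq_image:
  "{l :: 'a^'n::finite. \<forall>i. l $ i \<in> Z} = vec_lambda ` (PiE UNIV (\<lambda>_. Z))"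
proof (intro equalityI subsetI)
  fix l :: "'a^'n" assume "l \<in> {l. \<forall>i. l $ i \<in> Z}"
  then have "(\<lambda>i. l $ i) \<in> PiE UNIV (\<lambda>_. Z)" by auto
  then show "l \<in> vec_lambda ` (PiE UNIV (\<lambda>_. Z))" by (metis imageI vec_nth_inverse)
qed auto

lemma finite_vec_box: "finite Z \<Longrightarrow> finite {l :: 'a^'n::finite. \<forall>i. l $ i \<in> Z}"
  unfolding vec_box_eq_image by (intro finite_imageI finite_PiE) auto

text \<open>Distributivity over a finite box. With constant \<open>f\<close> it counts lattice
  points; with an inverse square it reduces a lattice sum to one coordinate.\<close>

lemma sum_vec_box_prod:
  fixes f :: "'a \<Rightarrow> real"
  assumes "finite Z"
  shows "(\<Sum>l\<in>{l :: 'a^'n::finite. \<forall>i. l $ i \<in> Z}. \<Prod>i\<in>UNIV. f (l $ i)) = (\<Sum>z\<in>Z. f z) ^ CARD('n)"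
proof -
  have "inj_on (vec_lambda :: _ \<Rightarrow> 'a^'n) (PiE UNIV (\<lambda>_. Z))"
    by (auto simp: inj_on_def vec_lambda_inject)
  then have "(\<Sum>l\<in>{l :: 'a^'n. \<forall>i. l $ i \<in> Z}. \<Prod>i\<in>UNIV. f (l $ i)) =
      (\<Sum>g\<in>PiE (UNIV :: 'n set) (\<lambda>_. Z). \<Prod>i\<in>UNIV. f (g i))"
    unfolding vec_box_eq_image by (subst sum.reindex) auto
  also have "\<dots> = (\<Prod>i\<in>(UNIV :: 'n set). \<Sum>z\<in>Z. f z)"
    by (rule prod_sum_PiE[symmetric]) (use assms in auto)
  finally show ?thesis by simp
qed

text \<open>With M = floor(r/h) the cube holds exactly (2M + 1)^n lattice points, n being the
  dimension. The lower bound serves to bound the norms of bumps from below, the upper one to count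
  their supports.\<close>

lemma hlat_box:
  assumes h: "0 < h" and r: "0 \<le> r"
  shows "finite {l :: real^'n::finite. l \<in> hlat h \<and> infnorm l \<le> r}"
    and "(r / h) ^ CARD('n) \<le> card {l :: real^'n. l \<in> hlat h \<and> infnorm l \<le> r}"
    and "card {l :: real^'n. l \<in> hlat h \<and> infnorm l \<le> r} \<le> (2 * r / h + 1) ^ CARD('n)"
proof -
  define M where "M = \<lfloor>r / h\<rfloor>"
  have M: "0 \<le> M" "of_int M \<le> r / h" "r / h < of_int M + 1"
    using h r by (auto simp: M_def)
  let ?Z = "(\<lambda>z. h * real_of_int z) ` {-M..M}"
  have inj: "inj_on (\<lambda>z. h * real_of_int z) {-M..M}"
    using h by (auto simp: inj_on_def)
  have le: "\<bar>h * real_of_int z\<bar> \<le> r \<longleftrightarrow> z \<in> {-M..M}" for z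
  proof -
    have "\<bar>h * real_of_int z\<bar> \<le> r \<longleftrightarrow> real_of_int \<bar>z\<bar> \<le> r / h"
      using h by (simp add: abs_mult pos_le_divide_eq mult.commute)
    also have "\<dots> \<longleftrightarrow> \<bar>z\<bar> \<le> M" by (simp add: M_def le_floor_iff)
    finally show ?thesis by (simp add: abs_le_iff) linarith
  qed
  have eq: "{l :: real^'n. l \<in> hlat h \<and> infnorm l \<le> r} = {l. \<forall>i. l $ i \<in> ?Z}" (is "?L = ?R")
  proof (intro equalityI subsetI)
    fix l :: "real^'n" assume l: "l \<in> ?L"
    have "l $ i \<in> ?Z" for i
    proof -
      obtain z where z: "l $ i = h * real_of_int z"
        using l by (auto simp: mem_hlat_iff)
      then have "\<bar>h * real_of_int z\<bar> \<le> r" using l by (metis (mono_tags) infnorm_le_iff mem_Collect_eq)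
      then show ?thesis using le z by blast
    qed
    then show "l \<in> ?R" by blast
  next
    fix l :: "real^'n" assume l: "l \<in> ?R"
    have z: "\<exists>z. l $ i = h * real_of_int z \<and> z \<in> {-M..M}" for i
    proof -
      have "l $ i \<in> ?Z" using l by (simp only: mem_Collect_eq)
      then show ?thesis by (rule imageE) blast
    qed
    then have "l \<in> hlat h" unfolding mem_hlat_iff by (metis rangeI)
    moreover have "\<bar>l $ i\<bar> \<le> r" for i
    proof -
      obtain z where "l $ i = h * real_of_int z" "z \<in> {-M..M}" using z by blast
      then show ?thesis using le[of z] by metis
    qed
    ultimately show "l \<in> ?L" by (simp add: infnorm_le_iff)
  qed
  show fin: "finite ?L" unfolding eq by (rule finite_vec_box) simp
  have "real (card ?L) = (\<Sum>z\<in>?Z. 1::real) ^ CARD('n)"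
    unfolding eq by (subst sum_vec_box_prod[symmetric]) auto
  also have "(\<Sum>z\<in>?Z. 1::real) = 2 * of_int M + 1"
    using M(1) by (simp add: card_image[OF inj])
  finally have card: "real (card ?L) = (2 * of_int M + 1) ^ CARD('n)" .
  show "(r / h) ^ CARD('n) \<le> card ?L"
    unfolding card using M h r by (intro power_mono) auto
  show "card ?L \<le> (2 * r / h + 1) ^ CARD('n)"
    unfolding card using M by (intro power_mono) auto
qed

lemma hlat_shifted_box:
  fixes a :: "real^'n::finite"
  assumes h: "0 < h" and r: "0 \<le> r" and a: "a \<in> hlat h"
  defines "X \<equiv> {l. l \<in> hlat h \<and> infnorm (l - a) \<le> r}"
  shows "finite X" and "(r / h) ^ CARD('n) \<le> card X" and "card X \<le> (2 * r / h + 1) ^ CARD('n)"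
proof -
  have "X = (\<lambda>l. l + a) ` {l. l \<in> hlat h \<and> infnorm l \<le> r}"
  proof (intro equalityI subsetI)
    fix l assume "l \<in> X"
    then have "l \<in> hlat h" "infnorm (l - a) \<le> r" unfolding X_def by simp_all
    then have "l - a \<in> {l. l \<in> hlat h \<and> infnorm l \<le> r}" using hlat_diff[OF _ a] by simp
    then show "l \<in> (\<lambda>l. l + a) ` {l. l \<in> hlat h \<and> infnorm l \<le> r}"
      by (rule rev_image_eqI) simp
  next
    fix l assume "l \<in> (\<lambda>l. l + a) ` {l. l \<in> hlat h \<and> infnorm l \<le> r}"
    then obtain x where "x \<in> hlat h" "infnorm x \<le> r" "l = x + a" by blast
    then show "l \<in> X" unfolding X_def using hlat_add[OF _ a] by simp
  qed
  moreover have "inj_on (\<lambda>l. l + a) {l. l \<in> hlat h \<and> infnorm l \<le> r}" by (simp add: inj_on_def)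
  ultimately show "finite X" "(r / h) ^ CARD('n) \<le> card X" "card X \<le> (2 * r / h + 1) ^ CARD('n)"
    using hlat_box[OF h r, where 'n='n] by (simp_all add: card_image)
qed

text \<open>Comparison with the series of 1/(1 + n)^2: i -> |i| is injective on each of the two
  half-lines, and h (1 + |i|) \<le> 1 + h |i| because h \<le> 1, which costs a factor 1/h^2.\<close>

lemma sum_inverse_squares_grid_bounded:
  assumes h: "0 < h" "h \<le> 1"
  shows "\<exists>C\<ge>0. \<forall>Z. finite Z \<longrightarrow> Z \<subseteq> range (\<lambda>z. h * real_of_int z) \<longrightarrow>
    (\<Sum>z\<in>Z. 1 / (1 + \<bar>z\<bar>)\<^sup>2) \<le> C"
proof -
  let ?f = "\<lambda>n::nat. 1 / (1 + real n)\<^sup>2"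
  have f: "summable ?f"
    using inverse_power_summable[of 2, where 'a=real] summable_Suc_iff[of "\<lambda>n. inverse (real n ^ 2)"]
    by (simp add: inverse_eq_divide)
  define C where "C = 1 / h\<^sup>2 * (2 * suminf ?f)"
  have sC: "0 \<le> suminf ?f" by (rule suminf_nonneg[OF f]) auto
  have half: "(\<Sum>i\<in>I. 1 / (1 + \<bar>real_of_int i\<bar>)\<^sup>2) \<le> suminf ?f"
    if "finite I" "inj_on (\<lambda>i. nat \<bar>i\<bar>) I" for I
  proof -
    have "(\<Sum>i\<in>I. 1 / (1 + \<bar>real_of_int i\<bar>)\<^sup>2) = (\<Sum>n\<in>(\<lambda>i. nat \<bar>i\<bar>) ` I. ?f n)"
      by (subst sum.reindex[OF that(2)]) (simp add: o_def)
    also have "\<dots> \<le> suminf ?f"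
      by (rule sum_le_suminf[OF f]) (use that in auto)
    finally show ?thesis .
  qed
  have "(\<Sum>z\<in>Z. 1 / (1 + \<bar>z\<bar>)\<^sup>2) \<le> C" if Z: "finite Z" "Z \<subseteq> range (\<lambda>z. h * real_of_int z)" for Z
  proof -
    obtain I where I: "Z = (\<lambda>z. h * real_of_int z) ` I" "finite I"
      using finite_subset_image[OF Z] by blast
    have inj: "inj_on (\<lambda>z. h * real_of_int z) I" using h by (auto simp: inj_on_def)
    have "(\<Sum>z\<in>Z. 1 / (1 + \<bar>z\<bar>)\<^sup>2) = (\<Sum>i\<in>I. 1 / (1 + h * \<bar>real_of_int i\<bar>)\<^sup>2)"
      unfolding I using h by (subst sum.reindex[OF inj]) (simp add: abs_mult)
    also have "\<dots> \<le> (\<Sum>i\<in>I. 1 / h\<^sup>2 * (1 / (1 + \<bar>real_of_int i\<bar>)\<^sup>2))"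
    proof (rule sum_mono)
      fix i
      have "(h * (1 + \<bar>real_of_int i\<bar>))\<^sup>2 \<le> (1 + h * \<bar>real_of_int i\<bar>)\<^sup>2"
        using h by (intro power_mono) (auto simp: algebra_simps)
      then show "1 / (1 + h * \<bar>real_of_int i\<bar>)\<^sup>2 \<le> 1 / h\<^sup>2 * (1 / (1 + \<bar>real_of_int i\<bar>)\<^sup>2)"
        using h by (simp add: frac_le power_mult_distrib add_pos_nonneg)
    qed
    also have "\<dots> = 1 / h\<^sup>2 * ((\<Sum>i\<in>I \<inter> {0..}. 1 / (1 + \<bar>real_of_int i\<bar>)\<^sup>2) + (\<Sum>i\<in>I - {0..}. 1 / (1 + \<bar>real_of_int i\<bar>)\<^sup>2))"
      by (simp only: sum_distrib_left sum.Int_Diff[OF I(2), of _ "{0..}"] distrib_left)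
    also have "\<dots> \<le> 1 / h\<^sup>2 * (suminf ?f + suminf ?f)"
      by (intro mult_left_mono add_mono half) (use I(2) in \<open>auto simp: inj_on_def\<close>)
    finally show ?thesis by (simp add: C_def)
  qed
  moreover have "0 \<le> C" using sC by (simp add: C_def)
  ultimately show ?thesis by blast
qed

text \<open>Every coordinate is bounded by the norm, so two powers of 1 + |l| per dimension dominate
  a product of one-dimensional inverse squares. The bound is uniform over finite sets, the form in
  which it enters Schur's test.\<close>

lemma hlat_sum_decay_bounded:
  assumes h: "0 < h" "h \<le> 1"
  shows "\<exists>C\<ge>0. \<forall>F. finite F \<longrightarrow> F \<subseteq> hlat h \<longrightarrow>
    (\<Sum>l\<in>F. 1 / (1 + norm (l :: real^'n::finite)) ^ (2 * CARD('n))) \<le> C"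
proof -
  obtain C where C: "0 \<le> C"
    and bound: "\<And>Z. finite Z \<Longrightarrow> Z \<subseteq> range (\<lambda>z. h * real_of_int z) \<Longrightarrow> (\<Sum>z\<in>Z. 1 / (1 + \<bar>z\<bar>)\<^sup>2) \<le> C"
    using sum_inverse_squares_grid_bounded[OF h] by auto
  have "(\<Sum>l\<in>F. 1 / (1 + norm l) ^ (2 * CARD('n))) \<le> C ^ CARD('n)"
    if F: "finite F" "F \<subseteq> hlat h" for F :: "(real^'n) set"
  proof -
    define Z where "Z = (\<Union>l\<in>F. range (\<lambda>i. l $ i))"
    have Z: "finite Z" "Z \<subseteq> range (\<lambda>z. h * real_of_int z)"
      using F by (auto simp: Z_def mem_hlat_iff)
    have "(\<Sum>l\<in>F. 1 / (1 + norm l) ^ (2 * CARD('n))) \<le> (\<Sum>l\<in>F. \<Prod>i\<in>UNIV. 1 / (1 + \<bar>l $ i\<bar>)\<^sup>2)"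
    proof (rule sum_mono)
      fix l :: "real^'n"
      have "(\<Prod>i\<in>(UNIV::'n set). 1 / (1 + norm l)\<^sup>2) \<le> (\<Prod>i\<in>UNIV. 1 / (1 + \<bar>l $ i\<bar>)\<^sup>2)"
        by (intro prod_mono conjI frac_le power_mono)
           (auto simp: component_le_norm_cart add_pos_nonneg)
      then show "1 / (1 + norm l) ^ (2 * CARD('n)) \<le> (\<Prod>i\<in>UNIV. 1 / (1 + \<bar>l $ i\<bar>)\<^sup>2)"
        by (simp add: power_mult power_one_over)
    qed
    also have "\<dots> \<le> (\<Sum>l\<in>{l :: real^'n. \<forall>i. l $ i \<in> Z}. \<Prod>i\<in>UNIV. 1 / (1 + \<bar>l $ i\<bar>)\<^sup>2)"
      by (intro sum_mono2 finite_vec_box Z prod_nonneg) (auto simp: Z_def)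
    also have "\<dots> = (\<Sum>z\<in>Z. 1 / (1 + \<bar>z\<bar>)\<^sup>2) ^ CARD('n)"
      by (rule sum_vec_box_prod[OF Z(1)])
    also have "\<dots> \<le> C ^ CARD('n)"
      by (intro power_mono bound Z sum_nonneg) auto
    finally show ?thesis .
  qed
  then show ?thesis using C by (intro exI[of _ "C ^ CARD('n)"]) auto
qed

section \<open>Peetre's inequality and Schur's test\<close>

lemma one_plus_norm_le_mult: "1 + norm a \<le> (1 + norm b) * (1 + norm (b - a))"
proof -
  have "norm a \<le> norm b + norm (b - a)"
    by (metis norm_minus_commute norm_triangle_sub add.commute)
  moreover have "0 \<le> norm b * norm (b - a)" by simp
  ultimately show ?thesis unfolding distrib_left distrib_right by linarith
qed

text \<open>For negative p the elementary inequality is applied with a and b exchanged. It moves a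
  weight from a to b at a polynomial price in b - a.\<close>

lemma peetre:
  "(1 + norm a) powr p \<le> (1 + norm b) powr p * (1 + norm (b - a)) powr \<bar>p\<bar>"
proof (cases "0 \<le> p")
  case True
  have "(1 + norm a) powr p \<le> ((1 + norm b) * (1 + norm (b - a))) powr p"
    using True by (intro powr_mono2 one_plus_norm_le_mult) auto
  then show ?thesis using True by (simp add: powr_mult)
next
  case False
  have "(1 + norm b) powr (- p) \<le> ((1 + norm a) * (1 + norm (b - a))) powr (- p)"
    using False one_plus_norm_le_mult[of b a] by (intro powr_mono2) (auto simp: norm_minus_commute)
  then have "(1 + norm b) powr (- p) \<le> (1 + norm a) powr (- p) * (1 + norm (b - a)) powr (- p)"
    by (simp add: powr_mult)
  moreover have "0 < (1 + norm a) powr p" "0 < (1 + norm b) powr p"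
    by (auto simp: add_nonneg_eq_0_iff)
  ultimately have "(1 + norm a) powr p \<le> (1 + norm b) powr p * (1 + norm (b - a)) powr (- p)"
    unfolding powr_minus[of "1 + norm a"] powr_minus[of "1 + norm b"] by (simp add: field_simps)
  then show ?thesis using False by simp
qed

text \<open>By x y \<le> (x^2 + y^2)/2 only row and column sums of the kernel matter, and these
  agree because the kernel is symmetric. The constant does not depend on \<open>A\<close> and
  \<open>B\<close>, so the estimate survives passage to the limit.\<close>

lemma schur_finite:
  assumes h: "0 < h" "h \<le> 1"
  shows "\<exists>C\<ge>0. \<forall>A B x y. finite A \<longrightarrow> A \<subseteq> hlat h \<longrightarrow> finite B \<longrightarrow> B \<subseteq> hlat h \<longrightarrow>
    (\<Sum>a\<in>A. \<Sum>b\<in>B. x a * y b / (1 + norm (b - a :: real^'n::finite)) ^ (2 * CARD('n)))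
      \<le> C * ((\<Sum>a\<in>A. (x a)\<^sup>2) + (\<Sum>b\<in>B. (y b)\<^sup>2))"
proof -
  obtain C where C: "0 \<le> C"
    and bound: "\<And>F. finite F \<Longrightarrow> F \<subseteq> hlat h \<Longrightarrow>
      (\<Sum>l\<in>F. 1 / (1 + norm (l :: real^'n)) ^ (2 * CARD('n))) \<le> C"
    using hlat_sum_decay_bounded[OF h] by auto
  let ?k = "\<lambda>a b :: real^'n. 1 / (1 + norm (b - a)) ^ (2 * CARD('n))"
  have row: "(\<Sum>b\<in>B. ?k a b) \<le> C" if "finite B" "B \<subseteq> hlat h" "a \<in> hlat h" for a B
  proof -
    have "(\<Sum>b\<in>B. ?k a b) = (\<Sum>l\<in>(\<lambda>b. b - a) ` B. 1 / (1 + norm l) ^ (2 * CARD('n)))"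
      by (subst sum.reindex) (auto simp: inj_on_def)
    also have "\<dots> \<le> C"
      by (rule bound) (use that hlat_diff in auto)
    finally show ?thesis .
  qed
  have k_sym: "?k a b = ?k b a" for a b by (simp add: norm_minus_commute)
  have "(\<Sum>a\<in>A. \<Sum>b\<in>B. x a * y b / (1 + norm (b - a)) ^ (2 * CARD('n)))
      \<le> C / 2 * ((\<Sum>a\<in>A. (x a)\<^sup>2) + (\<Sum>b\<in>B. (y b)\<^sup>2))"
    if A: "finite A" "A \<subseteq> hlat h" and B: "finite B" "B \<subseteq> hlat h" for A B :: "(real^'n) set" and x y
  proof -
    have "(\<Sum>a\<in>A. \<Sum>b\<in>B. x a * y b / (1 + norm (b - a)) ^ (2 * CARD('n)))
      \<le> (\<Sum>a\<in>A. \<Sum>b\<in>B. ((x a)\<^sup>2 / 2 + (y b)\<^sup>2 / 2) * ?k a b)"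
    proof (intro sum_mono)
      fix a b :: "real^'n"
      have "x a * y b \<le> (x a)\<^sup>2 / 2 + (y b)\<^sup>2 / 2"
        using sum_squares_bound[of "x a" "y b"] by simp
      from mult_right_mono[OF this, of "?k a b"]
      show "x a * y b / (1 + norm (b - a)) ^ (2 * CARD('n)) \<le> ((x a)\<^sup>2 / 2 + (y b)\<^sup>2 / 2) * ?k a b"
        by simp
    qed
    also have "\<dots> = (\<Sum>a\<in>A. (x a)\<^sup>2 / 2 * (\<Sum>b\<in>B. ?k a b)) + (\<Sum>b\<in>B. (y b)\<^sup>2 / 2 * (\<Sum>a\<in>A. ?k b a))"
      unfolding distrib_right sum.distrib sum_distrib_left
      by (subst (2) sum.swap) (simp add: norm_minus_commute)
    also have "\<dots> \<le> (\<Sum>a\<in>A. (x a)\<^sup>2 / 2 * C) + (\<Sum>b\<in>B. (y b)\<^sup>2 / 2 * C)"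
      by (intro add_mono sum_mono mult_left_mono row) (use A B in auto)
    also have "\<dots> = C / 2 * ((\<Sum>a\<in>A. (x a)\<^sup>2) + (\<Sum>b\<in>B. (y b)\<^sup>2))"
      by (simp add: distrib_left sum_distrib_left mult.commute)
    finally show ?thesis .
  qed
  then show ?thesis using C by (intro exI[of _ "C / 2"]) auto
qed

text \<open>After expanding both squares, the right-hand side exceeds the left-hand side by exactly
  (p - q)^2 / (p q).\<close>

lemma sum_normalized_diff_squared_le:
  fixes u v :: "'a \<Rightarrow> real"
  assumes p: "p\<^sup>2 = (\<Sum>x\<in>X. (u x)\<^sup>2)" "0 < p" and q: "q\<^sup>2 = (\<Sum>x\<in>X. (v x)\<^sup>2)" "0 < q"
  shows "(\<Sum>x\<in>X. (u x / p - v x / q)\<^sup>2) \<le> (\<Sum>x\<in>X. (u x - v x)\<^sup>2) / (p * q)"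
proof -
  define c where "c = (\<Sum>x\<in>X. u x * v x)"
  have "(\<Sum>x\<in>X. (u x / p - v x / q)\<^sup>2) =
      (\<Sum>x\<in>X. (u x)\<^sup>2) / p\<^sup>2 + (\<Sum>x\<in>X. (v x)\<^sup>2) / q\<^sup>2 - 2 / (p * q) * c"
    unfolding c_def sum_divide_distrib sum_distrib_left sum.distrib[symmetric] sum_subtractf[symmetric]
    by (intro sum.cong) (auto simp: power2_diff power_divide)
  also have "\<dots> = 2 - 2 / (p * q) * c" unfolding p(1)[symmetric] q(1)[symmetric] using p(2) q(2) by simp
  also have "\<dots> \<le> (p\<^sup>2 + q\<^sup>2 - 2 * c) / (p * q)"
  proof -
    have "(p\<^sup>2 + q\<^sup>2 - 2 * c) / (p * q) - (2 - 2 / (p * q) * c) = (p - q)\<^sup>2 / (p * q)"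
      using p(2) q(2) by (simp add: field_simps power2_eq_square)
    also have "\<dots> \<ge> 0" using p(2) q(2) by simp
    finally show ?thesis by simp
  qed
  also have "p\<^sup>2 + q\<^sup>2 - 2 * c = (\<Sum>x\<in>X. (u x - v x)\<^sup>2)"
    unfolding c_def p(1) q(1) sum_distrib_left sum.distrib[symmetric] sum_subtractf[symmetric]
    by (intro sum.cong) (auto simp: power2_diff)
  finally show ?thesis .
qed

text \<open>Half of the weight, (1 + |a|)^(p/2), is moved to b by Peetre's inequality; this uses up
  \<open>K\<close> \<ge> |p/2| powers of the off-diagonal decay, and the unweighted Schur test takes
  the rest.\<close>

lemma schur_weighted:
  assumes h: "0 < h" "h \<le> 1"
  shows "\<exists>N C. 0 \<le> C \<and> (\<forall>A B f g. finite A \<longrightarrow> A \<subseteq> hlat h \<longrightarrow> finite B \<longrightarrow> B \<subseteq> hlat h \<longrightarrow>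
    (\<Sum>a\<in>A. \<Sum>b\<in>B. (1 + norm a) powr p / (1 + norm (b - a :: real^'n::finite)) ^ N * (cmod (f a) * cmod (g b)))
      \<le> C * ((\<Sum>a\<in>A. (1 + norm a) powr p * (cmod (f a))\<^sup>2) + (\<Sum>b\<in>B. (1 + norm b) powr p * (cmod (g b))\<^sup>2)))"
proof -
  obtain C where C: "0 \<le> C" and schur: "\<And>A B x y. finite A \<Longrightarrow> A \<subseteq> hlat h \<Longrightarrow> finite B \<Longrightarrow> B \<subseteq> hlat h \<Longrightarrow>
    (\<Sum>a\<in>A. \<Sum>b\<in>B. x a * y b / (1 + norm (b - a :: real^'n)) ^ (2 * CARD('n)))
      \<le> C * ((\<Sum>a\<in>A. (x a)\<^sup>2) + (\<Sum>b\<in>B. (y b)\<^sup>2))"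
    using schur_finite[OF h, where 'n='n] by meson
  define K where "K = nat \<lceil>\<bar>p / 2\<bar>\<rceil>"
  define x where "x = (\<lambda>g (a::real^'n). (1 + norm a) powr (p / 2) * cmod (g a))"
  have x2: "(x g a)\<^sup>2 = (1 + norm a) powr p * (cmod (g a))\<^sup>2" for g a
  proof -
    have "((1 + norm a) powr (p / 2))\<^sup>2 = (1 + norm a) powr p"
      by (simp add: power2_eq_square flip: powr_add)
    then show ?thesis by (simp add: x_def power_mult_distrib)
  qed
  have pointwise: "(1 + norm a) powr p / (1 + norm (b - a)) ^ (2 * CARD('n) + K) * (cmod (f a) * cmod (g b))
      \<le> x f a * x g b / (1 + norm (b - a)) ^ (2 * CARD('n))" for f g and a b :: "real^'n"
  proof -
    have "(1 + norm (b - a)) powr \<bar>p / 2\<bar> \<le> (1 + norm (b - a)) powr real K"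
      by (intro powr_mono) (auto simp: K_def intro: order_trans[OF le_of_int_ceiling])
    also have "\<dots> = (1 + norm (b - a)) ^ K"
      by (intro powr_realpow) (auto simp: add_pos_nonneg)
    finally have K: "(1 + norm (b - a)) powr \<bar>p / 2\<bar> \<le> (1 + norm (b - a)) ^ K" .
    have "(1 + norm a) powr p = (1 + norm a) powr (p / 2) * (1 + norm a) powr (p / 2)"
      by (simp flip: powr_add)
    also have "\<dots> \<le> (1 + norm a) powr (p / 2) * ((1 + norm b) powr (p / 2) * (1 + norm (b - a)) ^ K)"
      by (intro mult_left_mono order_trans[OF peetre[of a _ b]] K) auto
    finally have "(1 + norm a) powr p \<le> (1 + norm a) powr (p / 2) * (1 + norm b) powr (p / 2) * (1 + norm (b - a)) ^ K"
      by simp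
    moreover have J: "0 < (1 + norm (b - a)) ^ K" "0 < (1 + norm (b - a)) ^ (2 * CARD('n))"
      by (auto simp: add_pos_nonneg)
    ultimately have "(1 + norm a) powr p / (1 + norm (b - a)) ^ K \<le> (1 + norm a) powr (p / 2) * (1 + norm b) powr (p / 2)"
      by (simp add: divide_le_eq)
    then have "(1 + norm a) powr p / (1 + norm (b - a)) ^ K * (cmod (f a) * cmod (g b)) / (1 + norm (b - a)) ^ (2 * CARD('n))
      \<le> (1 + norm a) powr (p / 2) * (1 + norm b) powr (p / 2) * (cmod (f a) * cmod (g b)) / (1 + norm (b - a)) ^ (2 * CARD('n))"
      using J by (intro divide_right_mono mult_right_mono) auto
    then show ?thesis by (simp add: x_def power_add mult_ac)
  qed
  show ?thesis
  proof (intro exI[of _ "2 * CARD('n) + K"] exI[of _ C] conjI allI impI C)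
    fix A B :: "(real^'n) set" and f g :: "real^'n \<Rightarrow> complex"
    assume AB: "finite A" "A \<subseteq> hlat h" "finite B" "B \<subseteq> hlat h"
    have "(\<Sum>a\<in>A. \<Sum>b\<in>B. (1 + norm a) powr p / (1 + norm (b - a)) ^ (2 * CARD('n) + K) * (cmod (f a) * cmod (g b)))
      \<le> (\<Sum>a\<in>A. \<Sum>b\<in>B. x f a * x g b / (1 + norm (b - a)) ^ (2 * CARD('n)))"
      by (intro sum_mono pointwise)
    also have "\<dots> \<le> C * ((\<Sum>a\<in>A. (x f a)\<^sup>2) + (\<Sum>b\<in>B. (x g b)\<^sup>2))"
      by (rule schur[OF AB])
    finally show "(\<Sum>a\<in>A. \<Sum>b\<in>B. (1 + norm a) powr p / (1 + norm (b - a)) ^ (2 * CARD('n) + K) * (cmod (f a) * cmod (g b)))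
      \<le> C * ((\<Sum>a\<in>A. (1 + norm a) powr p * (cmod (f a))\<^sup>2) + (\<Sum>b\<in>B. (1 + norm b) powr p * (cmod (g b))\<^sup>2))"
      unfolding x2 .
  qed
qed

subsection \<open>Bumps on the lattice\<close>

text \<open>
  The width of the bump at \<open>a\<close> is \<open>(1 + |a|)\<^sup>1\<^sup>/\<^sup>2\<close>: it balances the second-order Taylor error of the symbol,
  of size \<open>width\<^sup>2 (1 + |a|)\<^sup>m\<^sup>-\<^sup>2\<close>, against the error \<open>width\<^sup>-\<^sup>2 (1 + |a|)\<^sup>m\<close> caused by moving the bump.
\<close>

definition bump :: "real^'n::finite \<Rightarrow> real^'n \<Rightarrow> real" where
  "bump a \<xi> = max 0 (sqrt (1 + norm a) - infnorm (\<xi> - a))"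

text \<open>The sup norm makes this a cube, whose points can be counted coordinatewise. The bump
  vanishes on its boundary, so this set contains the support and may be larger.\<close>

definition bump_supp :: "real \<Rightarrow> real^'n::finite \<Rightarrow> (real^'n) set" where
  "bump_supp h a = {\<xi>. \<xi> \<in> hlat h \<and> infnorm (\<xi> - a) \<le> sqrt (1 + norm a)}"

definition bump_norm :: "real \<Rightarrow> real^'n::finite \<Rightarrow> real" where
  "bump_norm h a = sqrt (\<Sum>\<xi>\<in>bump_supp h a. (bump a \<xi>)\<^sup>2)"

definition nbump :: "real \<Rightarrow> real^'n::finite \<Rightarrow> real^'n \<Rightarrow> real" where
  "nbump h a \<xi> = bump a \<xi> / bump_norm h a"

lemma bump_eq_0: "\<xi> \<in> hlat h \<Longrightarrow> \<xi> \<notin> bump_supp h a \<Longrightarrow> bump a \<xi> = 0"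
  by (auto simp: bump_def bump_supp_def)

lemma finite_bump_supp: "0 < h \<Longrightarrow> a \<in> hlat h \<Longrightarrow> finite (bump_supp h a)"
  unfolding bump_supp_def by (intro hlat_shifted_box) auto

lemma bump_supp_subset: "bump_supp h a \<subseteq> hlat h"
  by (auto simp: bump_supp_def)

lemma infnorm_diff_le: "\<bar>infnorm (x - a) - infnorm (x - b)\<bar> \<le> norm (b - a)"
proof -
  have "infnorm (x - a) \<le> infnorm (x - b) + infnorm (b - a)"
    using infnorm_triangle[of "x - b" "b - a"] by simp
  moreover have "infnorm (x - b) \<le> infnorm (x - a) + infnorm (a - b)"
    using infnorm_triangle[of "x - a" "a - b"] by simp
  ultimately show ?thesis
    using infnorm_le_norm[of "b - a"] infnorm_sub[of a b] by linarith
qed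

lemma sqrt_one_plus_norm_diff: "\<bar>sqrt (1 + norm a) - sqrt (1 + norm b)\<bar> \<le> norm (b - a)"
proof -
  have *: "\<bar>sqrt x - sqrt y\<bar> \<le> \<bar>x - y\<bar>" if "1 \<le> x" "1 \<le> y" for x y :: real
  proof -
    have "x - y = (sqrt x - sqrt y) * (sqrt x + sqrt y)"
      using that by (simp add: algebra_simps)
    moreover have s: "1 \<le> sqrt x + sqrt y" using that real_sqrt_ge_1_iff[of x] real_sqrt_ge_zero[of y] by linarith
    ultimately have "\<bar>x - y\<bar> = \<bar>sqrt x - sqrt y\<bar> * (sqrt x + sqrt y)" by (simp add: abs_mult)
    then show ?thesis using mult_left_mono[OF s, of "\<bar>sqrt x - sqrt y\<bar>"] by simp
  qed
  have "\<bar>sqrt (1 + norm a) - sqrt (1 + norm b)\<bar> \<le> \<bar>norm a - norm b\<bar>"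
    using *[of "1 + norm a" "1 + norm b"] by simp
  also have "\<dots> \<le> norm (b - a)" by (metis norm_triangle_ineq3 norm_minus_commute)
  finally show ?thesis .
qed

text \<open>One unit of |b - a| comes from moving the centre, the other from changing the
  width.\<close>

lemma bump_lipschitz: "\<bar>bump a \<xi> - bump b \<xi>\<bar> \<le> 2 * norm (b - a)"
  using infnorm_diff_le[of \<xi> a b] sqrt_one_plus_norm_diff[of a b]
  unfolding bump_def by linarith

lemma bump_norm_squared: "(bump_norm h a)\<^sup>2 = (\<Sum>\<xi>\<in>bump_supp h a. (bump a \<xi>)\<^sup>2)"
  unfolding bump_norm_def by (simp add: sum_nonneg)

lemma bump_norm_squared_superset:
  assumes "finite X" "bump_supp h a \<subseteq> X" "X \<subseteq> hlat h"
  shows "(bump_norm h a)\<^sup>2 = (\<Sum>\<xi>\<in>X. (bump a \<xi>)\<^sup>2)"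
  unfolding bump_norm_squared
  by (rule sum.mono_neutral_left) (use assms in \<open>auto dest: bump_eq_0[rotated]\<close>)

text \<open>On the concentric cube of half the size the bump is at least t/2, where t is the width,
  and that cube holds at least (t/(2h))^n points. This explains the exponent n + 2.\<close>

lemma bump_norm_squared_ge:
  fixes a :: "real^'n::finite"
  assumes h: "0 < h" and a: "a \<in> hlat h"
  shows "1 / 4 * (1 / (2 * h)) ^ CARD('n) * sqrt (1 + norm a) ^ (CARD('n) + 2) \<le> (bump_norm h a)\<^sup>2"
proof -
  define t where "t = sqrt (1 + norm a)"
  have t: "0 < t" unfolding t_def by (simp add: add_pos_nonneg)
  let ?Y = "{\<xi>. \<xi> \<in> hlat h \<and> infnorm (\<xi> - a) \<le> t / 2}"
  have Y: "finite ?Y" "(t / 2 / h) ^ CARD('n) \<le> card ?Y"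
    using hlat_shifted_box[OF h _ a, of "t / 2"] t by auto
  have "1 / 4 * (1 / (2 * h)) ^ CARD('n) * t ^ (CARD('n) + 2) = (t / 2 / h) ^ CARD('n) * (t / 2)\<^sup>2"
    by (simp add: power_divide power_mult_distrib power_add power2_eq_square mult_ac)
  also have "\<dots> \<le> card ?Y * (t / 2)\<^sup>2"
    using Y by (intro mult_right_mono) auto
  also have "\<dots> = (\<Sum>\<xi>\<in>?Y. (t / 2)\<^sup>2)" by simp
  also have "\<dots> \<le> (\<Sum>\<xi>\<in>?Y. (bump a \<xi>)\<^sup>2)"
    using t by (intro sum_mono power_mono) (auto simp: bump_def simp flip: t_def)
  also have "\<dots> \<le> (\<Sum>\<xi>\<in>bump_supp h a. (bump a \<xi>)\<^sup>2)"
    using t by (intro sum_mono2 finite_bump_supp h a) (auto simp: bump_supp_def simp flip: t_def)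
  finally show ?thesis by (simp add: bump_norm_squared t_def)
qed

lemma bump_norm_pos:
  assumes h: "0 < h" and a: "a \<in> hlat h"
  shows "0 < bump_norm h a"
proof -
  have "0 < sqrt (1 + norm a)" by (simp add: add_pos_nonneg)
  then have "0 < 1 / 4 * (1 / (2 * h)) ^ CARD('a) * sqrt (1 + norm a) ^ (CARD('a) + 2)"
    using h by simp
  then have "0 < (bump_norm h a)\<^sup>2"
    using bump_norm_squared_ge[OF assms] by linarith
  moreover have "0 \<le> bump_norm h a" unfolding bump_norm_def by (simp add: sum_nonneg)
  ultimately show ?thesis by (simp add: less_le)
qed

lemma nbump_eq_0: "\<xi> \<in> hlat h \<Longrightarrow> \<xi> \<notin> bump_supp h a \<Longrightarrow> nbump h a \<xi> = 0"
  by (simp add: nbump_def bump_eq_0)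

lemma sum_nbump_squared:
  assumes "0 < h" "a \<in> hlat h" "finite X" "bump_supp h a \<subseteq> X" "X \<subseteq> hlat h"
  shows "(\<Sum>\<xi>\<in>X. (nbump h a \<xi>)\<^sup>2) = 1"
  using bump_norm_pos[OF assms(1,2)]
  by (simp add: nbump_def power_divide flip: sum_divide_distrib bump_norm_squared_superset[OF assms(3-5)])

lemma sqrt_one_plus_norm_le_mult: "sqrt (1 + norm a) \<le> sqrt (1 + norm b) * (1 + norm (b - a))"
proof -
  have "sqrt (1 + norm a) \<le> sqrt ((1 + norm b) * (1 + norm (b - a)))"
    using one_plus_norm_le_mult by simp
  also have "\<dots> = sqrt (1 + norm b) * sqrt (1 + norm (b - a))" by (rule real_sqrt_mult)
  also have "sqrt (1 + norm (b - a)) \<le> 1 + norm (b - a)"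
    by (rule real_le_lsqrt) (auto simp: power2_eq_square algebra_simps)
  finally show ?thesis by (simp add: mult_left_mono)
qed

text \<open>Let t = (1 + |a|)^(1/2) and J = 1 + |b - a|. Up to powers of J, the unnormalized bumps
  differ by O(1) on O(t^n) points, while their squared norms are at least of size t^(n+2); the
  quotient t^(-2) is the gain. The exponent 2n + 4 of J collects n from the point count, 2 from the
  Lipschitz bound and n + 2 from the norms.\<close>

lemma nbump_diff_squared_le:
  assumes h: "0 < h" "h \<le> 1"
  shows "\<exists>D\<ge>0. \<forall>a\<in>hlat h. \<forall>b\<in>hlat h. \<forall>X. finite X \<longrightarrow> bump_supp h a \<subseteq> X \<longrightarrow> bump_supp h b \<subseteq> X \<longrightarrow> X \<subseteq> hlat h \<longrightarrow>
    (\<Sum>\<xi>\<in>X. (nbump h a \<xi> - nbump h b \<xi>)\<^sup>2)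
      \<le> D * (1 + norm (b - a :: real^'n::finite)) ^ (2 * CARD('n) + 4) / (1 + norm a)"
proof -
  define c where "c = 1 / 4 * (1 / (2 * h)) ^ CARD('n)"
  have c: "0 < c" using h by (simp add: c_def)
  define D where "D = 8 * (3 / h) ^ CARD('n) / c"
  have "(\<Sum>\<xi>\<in>X. (nbump h a \<xi> - nbump h b \<xi>)\<^sup>2)
      \<le> D * (1 + norm (b - a)) ^ (2 * CARD('n) + 4) / (1 + norm a)"
    if a: "a \<in> hlat h" and b: "b \<in> hlat h"
      and X: "finite X" "bump_supp h a \<subseteq> X" "bump_supp h b \<subseteq> X" "X \<subseteq> hlat h"
    for a b :: "real^'n" and X
  proof -
    define t s l J where "t = sqrt (1 + norm a)" and "s = sqrt (1 + norm b)"
      and "l = norm (b - a)" and "J = 1 + l"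
    have J: "1 \<le> J" "0 \<le> l" "l \<le> J" by (auto simp: J_def l_def)
    have t: "1 \<le> t" "t\<^sup>2 = 1 + norm a" and s: "1 \<le> s" by (auto simp: t_def s_def)
    have st: "s \<le> t * J" "t \<le> s * J"
      using sqrt_one_plus_norm_le_mult[of b a] sqrt_one_plus_norm_le_mult[of a b]
      by (auto simp: t_def s_def J_def l_def norm_minus_commute)
    let ?Y = "bump_supp h a \<union> bump_supp h b"
    have tJ: "t \<le> t * J" "1 \<le> t * J" using t J mult_mono[of 1 t 1 J] by auto
    have card1: "real (card (bump_supp h x)) \<le> (3 * (t * J) / h) ^ CARD('n)"
      if "x \<in> hlat h" "sqrt (1 + norm x) \<le> t * J" for x :: "real^'n"
    proof -
      have "real (card (bump_supp h x)) \<le> (2 * sqrt (1 + norm x) / h + 1) ^ CARD('n)"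
        unfolding bump_supp_def by (rule hlat_shifted_box) (use h that in auto)
      also have "\<dots> \<le> (3 * (t * J) / h) ^ CARD('n)"
      proof (rule power_mono)
        have A: "2 * sqrt (1 + norm x) / h \<le> 2 * (t * J) / h" using h that by (intro divide_right_mono) auto
        \<comment> \<open>Since h \<le> 1, the additive 1 of the point count is absorbed into a
          third copy of t J / h.\<close>
        have B: "1 \<le> t * J / h" using h tJ by simp
        have C: "3 * (t * J) / h = 2 * (t * J) / h + t * J / h" by (simp flip: add_divide_distrib)
        show "2 * sqrt (1 + norm x) / h + 1 \<le> 3 * (t * J) / h"
          unfolding C by (rule add_mono[OF A B])
      qed (use h in auto)
      finally show ?thesis .
    qed
    have "(\<Sum>\<xi>\<in>X. (bump a \<xi> - bump b \<xi>)\<^sup>2) = (\<Sum>\<xi>\<in>?Y. (bump a \<xi> - bump b \<xi>)\<^sup>2)"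
    proof (rule sum.mono_neutral_right)
      show "\<forall>\<xi>\<in>X - ?Y. (bump a \<xi> - bump b \<xi>)\<^sup>2 = 0"
      proof
        fix \<xi> assume "\<xi> \<in> X - ?Y"
        then show "(bump a \<xi> - bump b \<xi>)\<^sup>2 = 0"
          using X(4) bump_eq_0[of \<xi> h a] bump_eq_0[of \<xi> h b] by auto
      qed
    qed (use X in auto)
    also have "\<dots> \<le> (\<Sum>\<xi>\<in>?Y. (2 * l)\<^sup>2)"
      unfolding l_def by (intro sum_mono) (metis abs_le_square_iff abs_of_nonneg bump_lipschitz mult_nonneg_nonneg norm_ge_zero zero_le_numeral)
    also have "\<dots> = real (card ?Y) * (4 * l\<^sup>2)" by (simp add: power_mult_distrib)
    also have "\<dots> \<le> (2 * (3 * (t * J) / h) ^ CARD('n)) * (4 * J\<^sup>2)"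
    proof (intro mult_mono)
      have "real (card ?Y) \<le> real (card (bump_supp h a)) + real (card (bump_supp h b))"
        by (metis card_Un_le of_nat_add of_nat_le_iff)
      also have "\<dots> \<le> 2 * (3 * (t * J) / h) ^ CARD('n)"
        using card1[OF a] card1[OF b] st(1) tJ by (simp add: t_def s_def)
      finally show "real (card ?Y) \<le> 2 * (3 * (t * J) / h) ^ CARD('n)" .
    qed (use J h t in \<open>auto simp: power_mono\<close>)
    finally have num: "(\<Sum>\<xi>\<in>X. (bump a \<xi> - bump b \<xi>)\<^sup>2) \<le> 8 * (3 * (t * J) / h) ^ CARD('n) * J\<^sup>2"
      by simp
    \<comment> \<open>Both widths, t and s, are at least t / J, so one lower bound serves for both
      squared norms and hence for the product of the norms.\<close>
    define z where "z = c * (t / J) ^ (CARD('n) + 2)"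
    have z: "0 < z" using c t J by (simp add: z_def)
    have tJ': "t / J \<le> t" "t / J \<le> s"
      using J(1) tJ(1) st(2) by (simp_all add: divide_le_eq)
    have za: "z \<le> (bump_norm h a)\<^sup>2"
    proof -
      have "z \<le> c * t ^ (CARD('n) + 2)"
        unfolding z_def using c t J tJ' by (intro mult_left_mono power_mono) auto
      then show ?thesis using bump_norm_squared_ge[OF h(1) a] by (simp add: t_def c_def)
    qed
    have zb: "z \<le> (bump_norm h b)\<^sup>2"
    proof -
      have "z \<le> c * s ^ (CARD('n) + 2)"
        unfolding z_def using c t J tJ' by (intro mult_left_mono power_mono) auto
      then show ?thesis using bump_norm_squared_ge[OF h(1) b] by (simp add: s_def c_def)
    qed
    have pos: "0 < bump_norm h a" "0 < bump_norm h b" using bump_norm_pos h a b by auto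
    have "sqrt z * sqrt z \<le> bump_norm h a * bump_norm h b"
      using za zb pos z by (intro mult_mono real_le_lsqrt) auto
    then have den: "z \<le> bump_norm h a * bump_norm h b" using z by simp
    have "(\<Sum>\<xi>\<in>X. (nbump h a \<xi> - nbump h b \<xi>)\<^sup>2) \<le> (\<Sum>\<xi>\<in>X. (bump a \<xi> - bump b \<xi>)\<^sup>2) / (bump_norm h a * bump_norm h b)"
      unfolding nbump_def
      by (rule sum_normalized_diff_squared_le) (use pos X bump_norm_squared_superset in auto)
    also have "\<dots> \<le> 8 * (3 * (t * J) / h) ^ CARD('n) * J\<^sup>2 / z"
      using num den z h t J by (intro frac_le) auto
    also have "\<dots> = D * J ^ (2 * CARD('n) + 4) / t\<^sup>2"
    proof -
      have "J ^ (2 * CARD('n) + 4) = J ^ CARD('n) * J\<^sup>2 * J ^ (CARD('n) + 2)"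
        unfolding power_add[symmetric] by (rule arg_cong[of _ _ "\<lambda>k. J ^ k"]) simp
      then show ?thesis
        using c t(1) J(1) h(1) unfolding z_def D_def
        by (simp add: power_divide power_mult_distrib power_add power2_eq_square field_simps)
    qed
    finally show ?thesis by (simp add: t J_def l_def)
  qed
  moreover have "0 \<le> D" using h c by (simp add: D_def)
  ultimately show ?thesis by blast
qed

section \<open>Taylor expansion on the lattice\<close>

lemma lattice_lipschitz:
  fixes f :: "real^'n::finite \<Rightarrow> complex"
  assumes h: "0 < h"
    and f: "\<And>k j. k \<in> hlat h \<Longrightarrow> infnorm (k - a) \<le> r \<Longrightarrow> cmod (f (k + h *\<^sub>R axis j 1) - f k) \<le> M"
    and x: "x \<in> hlat h" "infnorm (x - a) \<le> r"
    and y: "y \<in> hlat h" "infnorm (y - a) \<le> r"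
  shows "cmod (f x - f y) \<le> M * (\<Sum>i\<in>UNIV. \<bar>x $ i - y $ i\<bar>) / h"
proof -
  \<comment> \<open>Induction on the number \<open>N\<close> of unit steps from x to y. Each step
    moves one coordinate by h towards y, so the path stays coordinatewise between x and y and never
    leaves the cube where the difference bound is known.\<close>
  have step: "cmod (f x - f y) \<le> M * real N"
    if "(\<Sum>i\<in>UNIV. \<bar>x $ i - y $ i\<bar>) = h * real N" "x \<in> hlat h" "infnorm (x - a) \<le> r" for N x
    using that
  proof (induction N arbitrary: x)
    case 0
    then have "x = y" by (simp add: vec_eq_iff sum_nonneg_eq_0_iff)
    then show ?case by simp
  next
    case (Suc N)
    have "\<exists>j. x $ j \<noteq> y $ j"
    proof (rule ccontr)
      assume "\<not> ?thesis"
      then have "h * real (Suc N) = 0" using Suc.prems(1) by simp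
      then show False using h by simp
    qed
    then obtain j where j: "x $ j \<noteq> y $ j" by blast
    obtain p q where pq: "x $ j = h * real_of_int p" "y $ j = h * real_of_int q"
      using Suc.prems(2) y(1) unfolding mem_hlat_iff by blast
    have sumj: "(\<Sum>i\<in>UNIV. \<bar>z $ i - y $ i\<bar>) = \<bar>z $ j - y $ j\<bar> + (\<Sum>i\<in>UNIV - {j}. \<bar>z $ i - y $ i\<bar>)" for z :: "real^'n"
      by (rule sum.remove) auto
    \<comment> \<open>The bound is given for forward differences only; in a backward step
      \<open>x'\<close> takes the role of the base point, which is why it must be known to lie in
      the cube as well.\<close>
    obtain x' where x': "x' = x + h *\<^sub>R axis j 1 \<and> p < q \<or> x = x' + h *\<^sub>R axis j 1 \<and> q < p"
    proof (cases "p < q")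
      case True then show ?thesis using that by blast
    next
      case False
      then have "q < p" using j pq by auto
      then show ?thesis using that[of "x - h *\<^sub>R axis j 1"] by simp
    qed
    then have x'j: "x' $ j = h * real_of_int (if p < q then p + 1 else p - 1)"
      using pq by (auto simp: axis_def algebra_simps)
    have x'i: "x' $ i = x $ i" if "i \<noteq> j" for i
      using x' that by (auto simp: axis_def)
    have "x' = x + h *\<^sub>R axis j 1 \<or> x' = x - h *\<^sub>R axis j 1" using x' by auto
    then have lat: "x' \<in> hlat h"
      using Suc.prems(2) hlat_axis[of h j] by (auto intro: hlat_add hlat_diff)
    have dec: "\<bar>x' $ j - y $ j\<bar> = \<bar>x $ j - y $ j\<bar> - h"
    proof -
      have "\<bar>x' $ j - y $ j\<bar> = h * \<bar>real_of_int (if p < q then p + 1 else p - 1) - real_of_int q\<bar>"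
        unfolding x'j pq using h by (simp add: abs_mult flip: right_diff_distrib)
      moreover have "\<bar>x $ j - y $ j\<bar> = h * \<bar>real_of_int p - real_of_int q\<bar>"
        unfolding pq using h by (simp add: abs_mult flip: right_diff_distrib)
      moreover have "\<bar>real_of_int (if p < q then p + 1 else p - 1) - real_of_int q\<bar> = \<bar>real_of_int p - real_of_int q\<bar> - 1"
        using x' by (auto split: if_splits)
      ultimately show ?thesis by (simp add: right_diff_distrib)
    qed
    have "(\<Sum>i\<in>UNIV. \<bar>x' $ i - y $ i\<bar>) = (\<Sum>i\<in>UNIV. \<bar>x $ i - y $ i\<bar>) - h"
      unfolding sumj dec by (simp add: x'i)
    then have sum': "(\<Sum>i\<in>UNIV. \<bar>x' $ i - y $ i\<bar>) = h * real N"
      using Suc.prems(1) by (simp add: algebra_simps)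
    have inf': "infnorm (x' - a) \<le> r"
      unfolding infnorm_le_iff
    proof
      fix i
      have "min (x $ i) (y $ i) \<le> x' $ i \<and> x' $ i \<le> max (x $ i) (y $ i)"
      proof (cases "i = j")
        case True
        have "real_of_int (min p q) \<le> real_of_int (if p < q then p + 1 else p - 1)"
          "real_of_int (if p < q then p + 1 else p - 1) \<le> real_of_int (max p q)"
          using x' by (auto simp del: of_int_min of_int_max split: if_splits)
        then have "h * real_of_int (min p q) \<le> x' $ j" "x' $ j \<le> h * real_of_int (max p q)"
          unfolding x'j using h by (auto intro!: mult_left_mono)
        then show ?thesis unfolding True pq using h
          by (auto simp: min_def max_def split: if_splits)
      qed (simp add: x'i)
      moreover have "\<bar>x $ i - a $ i\<bar> \<le> r" "\<bar>y $ i - a $ i\<bar> \<le> r"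
        using Suc.prems(3) y(2) unfolding infnorm_le_iff by auto
      ultimately show "\<bar>(x' - a) $ i\<bar> \<le> r"
        by (auto simp: min_def max_def abs_le_iff split: if_splits)
    qed
    have "cmod (f x - f x') \<le> M"
      using x' f[OF Suc.prems(2,3), of j] f[OF lat inf', of j] by (auto simp: norm_minus_commute)
    moreover have "cmod (f x' - f y) \<le> M * real N"
      by (rule Suc.IH[OF sum' lat inf'])
    ultimately have "cmod (f x - f y) \<le> M + M * real N"
      by (rule norm_diff_triangle_le)
    then show ?case by (simp add: distrib_left)
  qed
  have "\<exists>N::nat. (\<Sum>i\<in>UNIV. \<bar>x $ i - y $ i\<bar>) = h * real N"
  proof -
    have "\<exists>z::int. x $ i - y $ i = h * real_of_int z" for i
      using hlat_diff[OF x(1) y(1)] unfolding mem_hlat_iff by auto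
    then obtain z :: "'n \<Rightarrow> int" where z: "\<And>i. x $ i - y $ i = h * real_of_int (z i)" by metis
    have "(\<Sum>i\<in>UNIV. \<bar>x $ i - y $ i\<bar>) = h * real (\<Sum>i\<in>UNIV. nat \<bar>z i\<bar>)"
      unfolding z using h by (simp add: abs_mult sum_distrib_left)
    then show ?thesis by blast
  qed
  then obtain N :: nat where N: "(\<Sum>i\<in>UNIV. \<bar>x $ i - y $ i\<bar>) = h * real N" by blast
  show ?thesis using step[OF N x] h unfolding N by simp
qed

lemma sum_abs_le_card_infnorm: "(\<Sum>i\<in>UNIV. \<bar>x $ i\<bar>) \<le> real CARD('n) * infnorm (x::real^'n::finite)"
  using sum_mono[of UNIV "\<lambda>i. \<bar>x $ i\<bar>" "\<lambda>_. infnorm x"] component_le_infnorm_cart[of x] by simp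

lemma lattice_lipschitz_infnorm:
  fixes f :: "real^'n::finite \<Rightarrow> complex"
  assumes h: "0 < h" and M: "0 \<le> M"
    and f: "\<And>k j. k \<in> hlat h \<Longrightarrow> infnorm (k - a) \<le> r \<Longrightarrow> cmod (f (k + h *\<^sub>R axis j 1) - f k) \<le> M"
    and x: "x \<in> hlat h" "infnorm (x - a) \<le> r"
    and y: "y \<in> hlat h" "infnorm (y - a) \<le> r"
    and d: "infnorm (x - y) \<le> d"
  shows "cmod (f x - f y) \<le> M * (real CARD('n) * d / h)"
proof -
  have "(\<Sum>i\<in>UNIV. \<bar>x $ i - y $ i\<bar>) \<le> real CARD('n) * infnorm (x - y)"
    using sum_abs_le_card_infnorm[of "x - y"] by simp
  also have "\<dots> \<le> real CARD('n) * d" using d by (intro mult_left_mono) auto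
  finally have "M * (\<Sum>i\<in>UNIV. \<bar>x $ i - y $ i\<bar>) / h \<le> M * (real CARD('n) * d) / h"
    using h M by (intro divide_right_mono mult_left_mono) auto
  then show ?thesis using lattice_lipschitz[OF h f x y] by simp
qed

text \<open>The expression equals g(a) - g(a - e) with g(x) = f(x + e) - f(x). The Lipschitz bound
  is used twice: on a first difference of f to control the differences of g, then on g itself. The
  base points lie within r of a and are shifted by e, hence the radius 2r in the hypothesis.\<close>

lemma lattice_symmetric_second_difference:
  fixes f :: "real^'n::finite \<Rightarrow> complex"
  assumes h: "0 < h" and M: "0 \<le> M"
    and f: "\<And>k i j. k \<in> hlat h \<Longrightarrow> infnorm (k - a) \<le> 2 * r \<Longrightarrow>
      cmod (f (k + h *\<^sub>R axis i 1 + h *\<^sub>R axis j 1) - f (k + h *\<^sub>R axis i 1) - (f (k + h *\<^sub>R axis j 1) - f k)) \<le> M"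
    and a: "a \<in> hlat h" and e: "e \<in> hlat h" "infnorm e \<le> r"
  shows "cmod (f (a + e) + f (a - e) - 2 * f a) \<le> M * (real CARD('n) * r / h)\<^sup>2"
proof -
  define g where "g x = f (x + e) - f x" for x
  have r: "0 \<le> r" using e(2) infnorm_pos_le order_trans by blast
  have g: "cmod (g (k + h *\<^sub>R axis j 1) - g k) \<le> M * (real CARD('n) * r / h)"
    if k: "k \<in> hlat h" "infnorm (k - a) \<le> r" for k j
  proof -
    define d where "d x = f (x + h *\<^sub>R axis j 1) - f x" for x
    have "cmod (d (k + e) - d k) \<le> M * (real CARD('n) * r / h)"
    proof (rule lattice_lipschitz_infnorm[OF h M, where a=a and r="2 * r"])
      show "cmod (d (k + h *\<^sub>R axis i 1) - d k) \<le> M" if "k \<in> hlat h" "infnorm (k - a) \<le> 2 * r" for k i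
        using f[OF that, of i j] by (simp add: d_def)
      show "infnorm (k + e - a) \<le> 2 * r"
        using infnorm_triangle[of "k - a" e] k e by (simp add: algebra_simps)
    qed (use k e r in \<open>auto intro: hlat_add\<close>)
    moreover have "g (k + h *\<^sub>R axis j 1) - g k = d (k + e) - d k"
      by (simp add: g_def d_def add_ac)
    ultimately show ?thesis by simp
  qed
  have "cmod (g a - g (a - e)) \<le> M * (real CARD('n) * r / h) * (real CARD('n) * r / h)"
    by (rule lattice_lipschitz_infnorm[OF h _ g])
       (use M r h a e in \<open>auto simp: infnorm_0 infnorm_neg intro: hlat_diff\<close>)
  moreover have "f (a + e) + f (a - e) - 2 * f a = g a - g (a - e)"
    by (simp add: g_def)
  ultimately show ?thesis by (simp add: power2_eq_square mult.assoc)
qed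

lemma infnorm_reflect: "infnorm (2 *\<^sub>R a - \<xi> - a) = infnorm (\<xi> - a)"
proof -
  have "2 *\<^sub>R a - \<xi> - a = - (\<xi> - a)" by (simp add: scaleR_2)
  then show ?thesis by (simp only: infnorm_neg)
qed

lemma nbump_reflect: "nbump h a (2 *\<^sub>R a - \<xi>) = nbump h a \<xi>"
  unfolding nbump_def bump_def infnorm_reflect ..

lemma bij_betw_bump_supp_reflect:
  assumes a: "a \<in> hlat h"
  shows "bij_betw (\<lambda>\<xi>. 2 *\<^sub>R a - \<xi>) (bump_supp h a) (bump_supp h a)"
proof (rule bij_betwI[where g="\<lambda>\<xi>. 2 *\<^sub>R a - \<xi>"])
  have "2 *\<^sub>R a - \<xi> \<in> bump_supp h a" if "\<xi> \<in> bump_supp h a" for \<xi>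
    using that hlat_diff[OF hlat_add[OF a a], of \<xi>] infnorm_reflect[of a \<xi>]
    by (simp add: bump_supp_def scaleR_2)
  then show "(\<lambda>\<xi>. 2 *\<^sub>R a - \<xi>) \<in> bump_supp h a \<rightarrow> bump_supp h a"
    "(\<lambda>\<xi>. 2 *\<^sub>R a - \<xi>) \<in> bump_supp h a \<rightarrow> bump_supp h a" by auto
qed auto

text \<open>Here f stands for a Fourier coefficient at a fixed frequency, as a function of the base
  point. Unit vectors satisfy sum u v = 1 - (sum (u - v)^2)/2, so normalization makes the
  zeroth-order error proportional to \<open>d\<close> and not to \<open>sqrt d\<close>; this is the
  term with \<open>M0\<close>. The terms with \<open>M1\<close> and \<open>M2\<close> bound
  \<open>A\<close>, by the Cauchy-Schwarz inequality, and \<open>B\<close>.\<close>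

lemma nbump_average_error:
  fixes f :: "real^'n::finite \<Rightarrow> complex"
  assumes h: "0 < h" and a: "a \<in> hlat h"
    and M1: "0 \<le> M1" "\<And>k j. k \<in> hlat h \<Longrightarrow> infnorm (k - a) \<le> 2 * sqrt (1 + norm a) \<Longrightarrow>
      cmod (f (k + h *\<^sub>R axis j 1) - f k) \<le> M1"
    and M2: "0 \<le> M2" "\<And>k i j. k \<in> hlat h \<Longrightarrow> infnorm (k - a) \<le> 2 * sqrt (1 + norm a) \<Longrightarrow>
      cmod (f (k + h *\<^sub>R axis i 1 + h *\<^sub>R axis j 1) - f (k + h *\<^sub>R axis i 1) - (f (k + h *\<^sub>R axis j 1) - f k)) \<le> M2"
    and M0: "cmod (f a) \<le> M0"
    and b: "b \<in> hlat h"
    and X: "finite X" "bump_supp h a \<subseteq> X" "bump_supp h b \<subseteq> X" "X \<subseteq> hlat h"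
    and d: "(\<Sum>\<xi>\<in>X. (nbump h a \<xi> - nbump h b \<xi>)\<^sup>2) \<le> d"
  defines "R \<equiv> real CARD('n) * sqrt (1 + norm a) / h"
  shows "cmod (f a - (\<Sum>\<xi>\<in>bump_supp h a. of_real (nbump h a \<xi> * nbump h b \<xi>) * f \<xi>))
    \<le> M1 * R * sqrt d + M2 * R\<^sup>2 / 2 + M0 * d / 2"
proof -
  let ?u = "nbump h a" and ?v = "nbump h b" and ?S = "bump_supp h a"
  define t where "t = sqrt (1 + norm a)"
  have t: "0 \<le> t" by (simp add: t_def)
  have R: "0 \<le> R" using h by (simp add: R_def)
  have S: "finite ?S" by (rule finite_bump_supp[OF h a])
  have uu: "(\<Sum>\<xi>\<in>X. (?u \<xi>)\<^sup>2) = 1" and vv: "(\<Sum>\<xi>\<in>X. (?v \<xi>)\<^sup>2) = 1" and uuS: "(\<Sum>\<xi>\<in>?S. (?u \<xi>)\<^sup>2) = 1"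
    using sum_nbump_squared[OF h] a b X S bump_supp_subset by blast+
  have restr: "(\<Sum>\<xi>\<in>X. of_real (?u \<xi> * w \<xi>) * F \<xi>) = (\<Sum>\<xi>\<in>?S. of_real (?u \<xi> * w \<xi>) * F \<xi>)" for w :: "real^'n \<Rightarrow> real" and F :: "real^'n \<Rightarrow> complex"
    by (rule sum.mono_neutral_right) (use X nbump_eq_0[of _ h a] in \<open>auto simp: subset_iff\<close>)
  have d0: "0 \<le> d" using d sum_nonneg[of X "\<lambda>\<xi>. (?u \<xi> - ?v \<xi>)\<^sup>2"] by simp

  \<comment> \<open>\<open>A\<close> is small because \<open>v\<close> is close to \<open>u\<close>, \<open>B\<close> because the evenness of \<open>u\<^sup>2\<close> about \<open>a\<close> cancels
    the first-order Taylor term.\<close>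
  define A where "A = (\<Sum>\<xi>\<in>?S. of_real (?u \<xi> * (?v \<xi> - ?u \<xi>)) * (f \<xi> - f a))"
  define B where "B = (\<Sum>\<xi>\<in>?S. of_real ((?u \<xi>)\<^sup>2) * (f \<xi> - f a))"
  define E where "E = (\<Sum>\<xi>\<in>X. (?u \<xi> - ?v \<xi>)\<^sup>2)"
  have cross: "(\<Sum>\<xi>\<in>X. ?u \<xi> * ?v \<xi>) = 1 - E / 2"
  proof -
    have "E = (\<Sum>\<xi>\<in>X. (?u \<xi>)\<^sup>2) + (\<Sum>\<xi>\<in>X. (?v \<xi>)\<^sup>2) - 2 * (\<Sum>\<xi>\<in>X. ?u \<xi> * ?v \<xi>)"
      unfolding E_def sum_distrib_left sum.distrib[symmetric] sum_subtractf[symmetric]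
      by (intro sum.cong) (auto simp: power2_diff)
    then show ?thesis unfolding uu vv by linarith
  qed
  have "(\<Sum>\<xi>\<in>?S. of_real (?u \<xi> * ?v \<xi>) * f \<xi>)
    = A + B + (\<Sum>\<xi>\<in>?S. of_real (?u \<xi> * ?v \<xi>) * f a)"
    unfolding A_def B_def sum.distrib[symmetric]
    by (intro sum.cong) (auto simp: algebra_simps power2_eq_square)
  also have "(\<Sum>\<xi>\<in>?S. of_real (?u \<xi> * ?v \<xi>) * f a) = (\<Sum>\<xi>\<in>X. of_real (?u \<xi> * ?v \<xi>) * f a)"
    by (rule restr[symmetric])
  also have "\<dots> = of_real (\<Sum>\<xi>\<in>X. ?u \<xi> * ?v \<xi>) * f a" by (simp add: sum_distrib_right)
  also have "\<dots> = f a - of_real (E / 2) * f a" unfolding cross by (simp add: algebra_simps)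
  finally have "f a - (\<Sum>\<xi>\<in>?S. of_real (?u \<xi> * ?v \<xi>) * f \<xi>) = of_real (E / 2) * f a - A - B"
    by simp
  moreover have "cmod (x - A - B) \<le> cmod x + cmod A + cmod B" for x
    using norm_triangle_ineq4[of "x - A" B] norm_triangle_ineq4[of x A] by linarith
  ultimately have "cmod (f a - (\<Sum>\<xi>\<in>?S. of_real (?u \<xi> * ?v \<xi>) * f \<xi>))
      \<le> cmod (of_real (E / 2) * f a) + cmod A + cmod B"
    by (simp only:)
  also have "cmod (of_real (E / 2) * f a) \<le> M0 * d / 2"
  proof -
    have "0 \<le> E" "E \<le> d" unfolding E_def using d by (auto intro: sum_nonneg)
    then have "E / 2 * cmod (f a) \<le> d / 2 * M0" using M0 d0 by (intro mult_mono) auto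
    then show ?thesis using \<open>0 \<le> E\<close> by (simp add: norm_mult mult.commute)
  qed
  also have "cmod A \<le> M1 * R * sqrt d"
  proof -
    have "cmod A \<le> (\<Sum>\<xi>\<in>?S. \<bar>?u \<xi>\<bar> * \<bar>?v \<xi> - ?u \<xi>\<bar> * (M1 * R))"
      unfolding A_def
    proof (rule sum_norm_le)
      fix \<xi> assume \<xi>: "\<xi> \<in> ?S"
      have \<xi>': "\<xi> \<in> hlat h" "infnorm (\<xi> - a) \<le> sqrt (1 + norm a)" using \<xi> by (auto simp: bump_supp_def)
      then have "infnorm (\<xi> - a) \<le> 2 * sqrt (1 + norm a)" using t unfolding t_def by linarith
      then have "cmod (f \<xi> - f a) \<le> M1 * R"
        unfolding R_def
        by (intro lattice_lipschitz_infnorm[OF h M1])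
           (use \<xi>' a t in \<open>auto simp: infnorm_0 t_def\<close>)
      then show "cmod (of_real (?u \<xi> * (?v \<xi> - ?u \<xi>)) * (f \<xi> - f a)) \<le> \<bar>?u \<xi>\<bar> * \<bar>?v \<xi> - ?u \<xi>\<bar> * (M1 * R)"
        unfolding norm_mult norm_of_real abs_mult by (intro mult_left_mono) auto
    qed
    also have "\<dots> = (\<Sum>\<xi>\<in>?S. \<bar>?u \<xi>\<bar> * \<bar>?v \<xi> - ?u \<xi>\<bar>) * (M1 * R)"
      by (simp add: sum_distrib_right)
    also have "\<dots> \<le> sqrt d * (M1 * R)"
    proof (rule mult_right_mono)
      have "(\<Sum>\<xi>\<in>?S. \<bar>?u \<xi>\<bar> * \<bar>?v \<xi> - ?u \<xi>\<bar>) \<le> L2_set ?u ?S * L2_set (\<lambda>\<xi>. ?v \<xi> - ?u \<xi>) ?S"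
        by (rule L2_set_mult_ineq)
      also have "L2_set ?u ?S = 1" by (simp add: L2_set_def uuS)
      also have "L2_set (\<lambda>\<xi>. ?v \<xi> - ?u \<xi>) ?S \<le> sqrt d"
      proof -
        have "(\<Sum>\<xi>\<in>?S. (?v \<xi> - ?u \<xi>)\<^sup>2) \<le> (\<Sum>\<xi>\<in>X. (?v \<xi> - ?u \<xi>)\<^sup>2)"
          using X by (intro sum_mono2) auto
        also have "\<dots> \<le> d" using d by (simp add: power2_commute)
        finally show ?thesis by (simp add: L2_set_def)
      qed
      finally show "(\<Sum>\<xi>\<in>?S. \<bar>?u \<xi>\<bar> * \<bar>?v \<xi> - ?u \<xi>\<bar>) \<le> sqrt d" by simp
    qed (use M1 R in auto)
    finally show ?thesis by (simp add: mult_ac)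
  qed
  also have "cmod B \<le> M2 * R\<^sup>2 / 2"
  proof -
    have "B = (\<Sum>\<xi>\<in>?S. of_real ((?u (2 *\<^sub>R a - \<xi>))\<^sup>2) * (f (2 *\<^sub>R a - \<xi>) - f a))"
      unfolding B_def by (rule sum.reindex_bij_betw[OF bij_betw_bump_supp_reflect[OF a], symmetric])
    then have "2 * B = B + (\<Sum>\<xi>\<in>?S. of_real ((?u \<xi>)\<^sup>2) * (f (2 *\<^sub>R a - \<xi>) - f a))"
      by (simp add: nbump_reflect)
    also have "\<dots> = (\<Sum>\<xi>\<in>?S. of_real ((?u \<xi>)\<^sup>2) * (f \<xi> + f (2 *\<^sub>R a - \<xi>) - 2 * f a))"
      unfolding B_def sum.distrib[symmetric] by (intro sum.cong) (auto simp: algebra_simps)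
    finally have "cmod (2 * B) \<le> (\<Sum>\<xi>\<in>?S. (?u \<xi>)\<^sup>2 * (M2 * R\<^sup>2))"
    proof (elim ssubst, intro sum_norm_le)
      fix \<xi> assume \<xi>: "\<xi> \<in> ?S"
      have "cmod (f (a + (\<xi> - a)) + f (a - (\<xi> - a)) - 2 * f a) \<le> M2 * R\<^sup>2"
        unfolding R_def
        by (rule lattice_symmetric_second_difference[OF h M2])
           (use \<xi> a in \<open>auto simp: bump_supp_def intro: hlat_diff\<close>)
      also have "a - (\<xi> - a) = 2 *\<^sub>R a - \<xi>" by (simp add: scaleR_2)
      finally show "cmod (of_real ((?u \<xi>)\<^sup>2) * (f \<xi> + f (2 *\<^sub>R a - \<xi>) - 2 * f a)) \<le> (?u \<xi>)\<^sup>2 * (M2 * R\<^sup>2)"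
        by (simp add: norm_mult norm_power mult_left_mono)
    qed
    also have "\<dots> = M2 * R\<^sup>2" using uuS by (simp flip: sum_distrib_right)
    finally show ?thesis by (simp add: norm_mult)
  qed
  finally show ?thesis by simp
qed

subsection \<open>Fourier coefficients of symbols\<close>

lemma has_vector_derivative_along_axis:
  fixes v :: "real^'n::finite \<Rightarrow> complex"
  assumes "\<And>\<theta>. v differentiable (at \<theta>)"
  shows "((\<lambda>t. v (\<theta> + t *\<^sub>R axis j 1)) has_vector_derivative pderiv_at j v (\<theta> + t *\<^sub>R axis j 1)) (at t within S)"
proof -
  let ?\<theta>t = "\<theta> + t *\<^sub>R axis j 1"
  have 1: "(v has_derivative frechet_derivative v (at ?\<theta>t)) (at ?\<theta>t)"
    using assms frechet_derivative_works by blast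
  have "((\<lambda>t. \<theta> + t *\<^sub>R axis j 1) has_derivative (\<lambda>s. s *\<^sub>R axis j 1)) (at t within S)"
    by (auto intro!: derivative_eq_intros)
  from has_derivative_compose[OF this 1]
  show ?thesis
    unfolding has_vector_derivative_def pderiv_at_def
    using linear_frechet_derivative[of v "at ?\<theta>t"] assms
    by (simp add: linear_cmul)
qed

text \<open>The shifted cube is cut where its j-th coordinate equals 1; the part above is moved back
  by one period and fills the slab that the shift had left empty.\<close>

lemma integral_shift_unit_cube:
  fixes v :: "real^'n::finite \<Rightarrow> complex"
  assumes cont: "continuous_on UNIV v" and per: "\<And>\<theta>. v (\<theta> + axis j 1) = v \<theta>"
    and t: "0 \<le> t" "t \<le> 1"
  shows "integral (cbox 0 1) (\<lambda>\<theta>. v (\<theta> + t *\<^sub>R axis j 1)) = integral (cbox 0 1) v"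
proof -
  let ?e = "axis j 1 :: real^'n"
  have int: "v integrable_on cbox a b" for a b
    by (rule integrable_continuous) (rule continuous_on_subset[OF cont], simp)
  have e: "?e \<in> Basis" by simp
  have ip: "x \<bullet> ?e = x $ j" for x :: "real^'n"
    by (simp add: inner_axis)
  have s1: "cbox (t *\<^sub>R ?e) (1 + t *\<^sub>R ?e) \<inter> {x. x \<bullet> ?e \<le> 1} = cbox (t *\<^sub>R ?e) 1"
    using t unfolding ip by (auto simp: mem_box_cart axis_def split: if_splits; force)
  have s2: "cbox (t *\<^sub>R ?e) (1 + t *\<^sub>R ?e) \<inter> {x. x \<bullet> ?e \<ge> 1} = cbox (0 + ?e) ((1 - ?e + t *\<^sub>R ?e) + ?e)"
    using t unfolding ip by (auto simp: mem_box_cart axis_def split: if_splits; force)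
  have s3: "cbox 0 1 \<inter> {x. x \<bullet> ?e \<le> t} = cbox 0 (1 - ?e + t *\<^sub>R ?e)"
    using t unfolding ip by (auto simp: mem_box_cart axis_def split: if_splits; force)
  have s4: "cbox 0 1 \<inter> {x. x \<bullet> ?e \<ge> t} = cbox (t *\<^sub>R ?e) 1"
    using t unfolding ip by (auto simp: mem_box_cart axis_def split: if_splits; metis order_trans)
  have "integral (cbox 0 1) (\<lambda>\<theta>. v (\<theta> + t *\<^sub>R ?e)) = integral (cbox 0 1) (v \<circ> ((+) (t *\<^sub>R ?e)))"
    by (simp add: o_def add.commute)
  also have "\<dots> = integral (cbox (t *\<^sub>R ?e) (1 + t *\<^sub>R ?e)) v"
    by (subst integral_shift_cbox_plus) simp
  also have "\<dots> = integral (cbox (t *\<^sub>R ?e) 1) v + integral (cbox (0 + ?e) ((1 - ?e + t *\<^sub>R ?e) + ?e)) v"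
    by (subst integral_split[OF int e, of _ _ 1]) (simp only: s1 s2)
  also have "integral (cbox (0 + ?e) ((1 - ?e + t *\<^sub>R ?e) + ?e)) v = integral (cbox 0 (1 - ?e + t *\<^sub>R ?e)) (v \<circ> ((+) ?e))"
    by (rule integral_shift_cbox_plus[symmetric])
  also have "v \<circ> ((+) ?e) = v"
    using per by (auto simp: o_def add.commute)
  also have "integral (cbox (t *\<^sub>R ?e) 1) v + integral (cbox 0 (1 - ?e + t *\<^sub>R ?e)) v = integral (cbox 0 1) v"
    by (subst integral_split[OF int e, of 0 1 t]) (simp only: s3 s4 add.commute)
  finally show ?thesis .
qed

text \<open>The integral of the translate by t in direction j does not depend on t, and
  differentiation under the integral sign at t = 0 gives the claim. Shifts with t in [0,1] suffice,
  so the derivative is one-sided.\<close>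

lemma integral_pderiv_at_periodic:
  fixes v :: "real^'n::finite \<Rightarrow> complex"
  assumes diff: "\<And>\<theta>. v differentiable (at \<theta>)"
    and cont: "continuous_on UNIV (pderiv_at j v)"
    and per: "\<And>\<theta>. v (\<theta> + axis j 1) = v \<theta>"
  shows "integral (cbox 0 1) (pderiv_at j v) = 0"
proof -
  let ?e = "axis j 1 :: real^'n"
  have contv: "continuous_on UNIV v"
    using diff by (meson continuous_at_imp_continuous_on differentiable_imp_continuous_within)
  let ?F = "\<lambda>t. integral (cbox 0 1) (\<lambda>\<theta>. v (\<theta> + t *\<^sub>R ?e))"
  have "(?F has_vector_derivative integral (cbox 0 1) (\<lambda>\<theta>. pderiv_at j v (\<theta> + 0 *\<^sub>R ?e))) (at 0 within {0..1})"
  proof (rule leibniz_rule_vector_derivative)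
    show "((\<lambda>t. v (\<theta> + t *\<^sub>R ?e)) has_vector_derivative pderiv_at j v (\<theta> + t *\<^sub>R ?e)) (at t within {0..1})" for t \<theta>
      by (rule has_vector_derivative_along_axis[OF diff])
    show "(\<lambda>\<theta>. v (\<theta> + t *\<^sub>R ?e)) integrable_on cbox 0 1" for t
      by (intro integrable_continuous continuous_on_compose2[OF contv] continuous_intros) auto
    show "continuous_on ({0..1} \<times> cbox 0 1) (\<lambda>(t, \<theta>). pderiv_at j v (\<theta> + t *\<^sub>R ?e))"
      unfolding case_prod_beta
      by (intro continuous_on_compose2[OF cont] continuous_intros) auto
  qed auto
  moreover have "((\<lambda>_. integral (cbox 0 1) v) has_vector_derivative 0) (at 0 within {0..1::real})"
    by (rule has_vector_derivative_const)
  then have "(?F has_vector_derivative 0) (at 0 within {0..1})"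
    by (rule has_vector_derivative_transform[rotated 2])
       (use integral_shift_unit_cube[OF contv per] in auto)
  ultimately show ?thesis
    using vector_derivative_unique_within_closed_interval[of 0 1 0 ?F] by auto
qed

lemma Ck_linear:
  fixes u v :: "real^'n::finite \<Rightarrow> complex"
  assumes "Ck r u" "Ck r v"
  shows "Ck r (\<lambda>\<theta>. c * u \<theta> + d * v \<theta>)"
  using assms
proof (induction r arbitrary: u v)
  case 0
  then show ?case by (auto intro!: continuous_intros)
next
  case (Suc r)
  have "pderiv_at j (\<lambda>\<theta>. c * u \<theta> + d * v \<theta>) = (\<lambda>\<theta>. c * pderiv_at j u \<theta> + d * pderiv_at j v \<theta>)" for j
  proof
    fix \<theta>
    have "(u has_derivative frechet_derivative u (at \<theta>)) (at \<theta>)"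
      and "(v has_derivative frechet_derivative v (at \<theta>)) (at \<theta>)"
      using Suc.prems by (auto simp flip: frechet_derivative_works)
    then have "((\<lambda>\<theta>. c * u \<theta> + d * v \<theta>) has_derivative
        (\<lambda>x. c * frechet_derivative u (at \<theta>) x + d * frechet_derivative v (at \<theta>) x)) (at \<theta>)"
      by (intro derivative_intros)
    from frechet_derivative_at[OF this]
    show "pderiv_at j (\<lambda>\<theta>. c * u \<theta> + d * v \<theta>) \<theta> = c * pderiv_at j u \<theta> + d * pderiv_at j v \<theta>"
      unfolding pderiv_at_def by metis
  qed
  then show ?case
    using Suc by auto
qed

lemma torus_smooth_linear:
  assumes "torus_smooth u" "torus_smooth v"
  shows "torus_smooth (\<lambda>\<theta>. c * u \<theta> + d * v \<theta>)"
  using assms unfolding torus_smooth_def by (simp add: Ck_linear)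

lemma torus_smooth_continuous_on: "torus_smooth u \<Longrightarrow> continuous_on S u"
  unfolding torus_smooth_def by (meson Ck.simps(1) continuous_on_subset subset_UNIV)

lemma torus_smooth_differentiable: "torus_smooth u \<Longrightarrow> u differentiable (at \<theta>)"
  unfolding torus_smooth_def by (meson Ck.simps(2))

lemma torus_smooth_pderiv_at:
  assumes "torus_smooth u"
  shows "torus_smooth (pderiv_at j u)"
proof -
  have "pderiv_at j u (\<theta> + axis i 1) = pderiv_at j u \<theta>" for \<theta> i
  proof -
    let ?e = "axis i 1 :: real^'a"
    have "(u has_derivative frechet_derivative u (at (\<theta> + ?e))) (at (\<theta> + ?e))"
      using torus_smooth_differentiable[OF assms] frechet_derivative_works by blast
    moreover have "((\<lambda>\<theta>. \<theta> + ?e) has_derivative (\<lambda>x. x)) (at \<theta>)"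
      by (auto intro!: derivative_eq_intros)
    ultimately have "((\<lambda>\<theta>. u (\<theta> + ?e)) has_derivative frechet_derivative u (at (\<theta> + ?e))) (at \<theta>)"
      using has_derivative_compose by fastforce
    moreover have "(\<lambda>\<theta>. u (\<theta> + ?e)) = u"
      using assms by (auto simp: torus_smooth_def)
    ultimately show ?thesis
      unfolding pderiv_at_def by (metis frechet_derivative_at)
  qed
  moreover have "Ck r (pderiv_at j u)" for r
    using assms unfolding torus_smooth_def by (meson Ck.simps(2))
  ultimately show ?thesis
    unfolding torus_smooth_def by blast
qed

lemma torus_smooth_tor_factor: "torus_smooth u \<Longrightarrow> torus_smooth (tor_factor j l u)"
  using torus_smooth_linear[of "pderiv_at j u" u "1 / (2 * of_real pi * \<i>)" "- of_nat l"]
    torus_smooth_pderiv_at[of u j]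
  by (simp add: tor_factor_def [abs_def])

text \<open>The index is a lattice point, so the ordinary integer frequency is \<open>l / h\<close>;
  the character is periodic on the torus exactly when \<open>l\<close> lies in
  \<open>hlat h\<close>.\<close>

definition echar :: "real \<Rightarrow> real^'n::finite \<Rightarrow> real^'n \<Rightarrow> complex" where
  "echar h l \<theta> = exp (- 2 * of_real pi * \<i> / of_real h * of_real (l \<bullet> \<theta>))"

lemma norm_echar [simp]: "cmod (echar h l \<theta>) = 1"
  by (simp add: echar_def)

lemma cnj_echar: "cnj (echar h l \<theta>) = echar h (- l) \<theta>"
  by (simp add: echar_def exp_cnj)

lemma echar_add: "echar h (a + b) \<theta> = echar h a \<theta> * echar h b \<theta>"
  by (simp add: echar_def inner_add_left distrib_left add_divide_distrib flip: exp_add)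

lemma continuous_on_echar [continuous_intros]: "continuous_on S (echar h l)"
  unfolding echar_def [abs_def] by (intro continuous_intros)

definition fcoeff :: "real \<Rightarrow> (real^'n::finite \<Rightarrow> complex) \<Rightarrow> real^'n \<Rightarrow> complex" where
  "fcoeff h u l = integral (cbox 0 1) (\<lambda>\<theta>. u \<theta> * echar h l \<theta>)"

lemma integrable_echar:
  fixes u :: "real^'n::finite \<Rightarrow> complex"
  assumes "torus_smooth u"
  shows "(\<lambda>\<theta>. u \<theta> * echar h l \<theta>) integrable_on cbox 0 1"
  using assms by (intro integrable_continuous continuous_intros torus_smooth_continuous_on)

lemma fcoeff_linear:
  assumes "torus_smooth u" "torus_smooth v"
  shows "fcoeff h (\<lambda>\<theta>. c * u \<theta> + d * v \<theta>) l = c * fcoeff h u l + d * fcoeff h v l"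
proof -
  have "fcoeff h (\<lambda>\<theta>. c * u \<theta> + d * v \<theta>) l =
      integral (cbox 0 1) (\<lambda>\<theta>. c * (u \<theta> * echar h l \<theta>) + d * (v \<theta> * echar h l \<theta>))"
    by (simp add: fcoeff_def algebra_simps)
  then show ?thesis
    using integral_add[OF integrable_on_mult_right[OF integrable_echar[OF assms(1)]]
        integrable_on_mult_right[OF integrable_echar[OF assms(2)]], of c h l d h l]
    by (simp add: fcoeff_def)
qed

lemma norm_fcoeff_le:
  assumes "\<And>\<theta>. cmod (u \<theta>) \<le> B"
  shows "cmod (fcoeff h u l) \<le> B"
proof -
  have B: "0 \<le> B" using assms[of 0] norm_ge_zero order_trans by blast
  have "cmod (integral (cbox 0 1) (\<lambda>\<theta>. u \<theta> * echar h l \<theta>)) \<le> B * measure lborel (cbox (0::real^'a) 1)"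
  proof (cases "(\<lambda>\<theta>. u \<theta> * echar h l \<theta>) integrable_on cbox 0 1")
    \<comment> \<open>If the product is not integrable, its integral is 0 by default, which the
      nonnegative \<open>B\<close> bounds as well.\<close>
    case True
    show ?thesis
      by (rule has_integral_bound[OF B integrable_integral[OF True]])
         (simp add: norm_mult assms)
  qed (simp add: not_integrable_integral B)
  moreover have "measure lborel (cbox (0::real^'a) 1) = 1"
    by (simp add: content_cbox_if_cart interval_ne_empty_cart)
  ultimately show ?thesis by (simp add: fcoeff_def)
qed

lemma echar_periodic:
  assumes "0 < h" "l \<in> hlat h"
  shows "echar h l (\<theta> + axis j 1) = echar h l \<theta>"
proof -
  obtain z :: int where z: "l $ j = h * of_int z" using assms(2) unfolding mem_hlat_iff by blast
  have "echar h l (\<theta> + axis j 1) = echar h l \<theta> * exp (- 2 * of_real pi * \<i> / of_real h * of_real (h * of_int z))"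
    using assms
    by (simp add: echar_def inner_add_right inner_axis distrib_left add_divide_distrib z flip: exp_add)
  also have "- 2 * of_real pi * \<i> / of_real h * of_real (h * of_int z) = 2 * of_real pi * \<i> * of_int (- z)"
    using assms by simp
  also have "exp \<dots> = 1"
    by (simp only: exp_eq_1) (auto intro!: exI[of _ "- z"])
  finally show ?thesis by simp
qed

text \<open>Integration by parts without boundary term: \<open>u\<close> times the character is
  periodic because \<open>l\<close> is a lattice point, so the integral of its derivative
  vanishes.\<close>

lemma fcoeff_pderiv_at:
  fixes u :: "real^'n::finite \<Rightarrow> complex"
  assumes h: "0 < h" "l \<in> hlat h" and u: "torus_smooth u"
  shows "fcoeff h (pderiv_at j u) l = 2 * of_real pi * \<i> * of_real (l $ j / h) * fcoeff h u l"
proof -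
  define c where "c = - 2 * of_real pi * \<i> / of_real h * of_real (l $ j)"
  let ?v = "\<lambda>\<theta>. u \<theta> * echar h l \<theta>"
  have der: "(?v has_derivative (\<lambda>x. u \<theta> * (echar h l \<theta> * (- 2 * of_real pi * \<i> / of_real h * of_real (l \<bullet> x)))
      + frechet_derivative u (at \<theta>) x * echar h l \<theta>)) (at \<theta>)" for \<theta>
  proof -
    have 1: "(u has_derivative frechet_derivative u (at \<theta>)) (at \<theta>)"
      using torus_smooth_differentiable[OF u] frechet_derivative_works by blast
    have "((\<lambda>\<theta>. - 2 * of_real pi * \<i> / of_real h * of_real (l \<bullet> \<theta>)) has_derivative
       (\<lambda>x. - 2 * of_real pi * \<i> / of_real h * of_real (l \<bullet> x))) (at \<theta>)"
      by (intro derivative_eq_intros) (auto intro!: derivative_eq_intros)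
    moreover have "(exp has_derivative (*) (exp z)) (at z)" for z :: complex
      using DERIV_exp has_field_derivative_def by blast
    ultimately have "(echar h l has_derivative
       (\<lambda>x. echar h l \<theta> * (- 2 * of_real pi * \<i> / of_real h * of_real (l \<bullet> x)))) (at \<theta>)"
      unfolding echar_def [abs_def] by (rule has_derivative_compose)
    from has_derivative_mult[OF 1 this] show ?thesis .
  qed
  have pd: "pderiv_at j ?v = (\<lambda>\<theta>. pderiv_at j u \<theta> * echar h l \<theta> + c * (u \<theta> * echar h l \<theta>))"
  proof
    fix \<theta>
    show "pderiv_at j ?v \<theta> = pderiv_at j u \<theta> * echar h l \<theta> + c * (u \<theta> * echar h l \<theta>)"
      using frechet_derivative_at[OF der[of \<theta>], symmetric]
      by (simp add: pderiv_at_def inner_axis c_def)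
  qed
  have "integral (cbox 0 1) (pderiv_at j ?v) = 0"
  proof (rule integral_pderiv_at_periodic)
    show "?v differentiable (at \<theta>)" for \<theta>
      using der differentiable_def by blast
    show "continuous_on UNIV (pderiv_at j ?v)"
      unfolding pd
      by (intro continuous_intros torus_smooth_continuous_on u torus_smooth_pderiv_at)
    show "?v (\<theta> + axis j 1) = ?v \<theta>" for \<theta>
      using u by (simp add: echar_periodic[OF h] torus_smooth_def)
  qed
  then have "fcoeff h (pderiv_at j u) l + c * fcoeff h u l = 0"
    unfolding pd fcoeff_def
    using integral_add[OF integrable_echar[OF torus_smooth_pderiv_at[OF u], of j h l]
        integrable_on_mult_right[OF integrable_echar[OF u, of h l], of c]]
    by simp
  then show ?thesis
    unfolding c_def by (simp add: field_simps eq_neg_iff_add_eq_0 add_eq_0_iff)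
qed

lemma fcoeff_tor_factor:
  assumes h: "0 < h" "l \<in> hlat h" and u: "torus_smooth u"
  shows "fcoeff h (tor_factor j r u) l = of_real (l $ j / h - of_nat r) * fcoeff h u l"
proof -
  have "fcoeff h (tor_factor j r u) l =
     1 / (2 * of_real pi * \<i>) * fcoeff h (pderiv_at j u) l + (- of_nat r) * fcoeff h u l"
    using fcoeff_linear[OF torus_smooth_pderiv_at[OF u] u, of h "1 / (2 * of_real pi * \<i>)" j "- of_nat r" l]
    by (simp add: tor_factor_def [abs_def])
  also have "\<dots> = of_real (l $ j / h - of_nat r) * fcoeff h u l"
    by (simp add: fcoeff_pderiv_at[OF assms] field_simps)
  finally show ?thesis .
qed

lemma fcoeff_foldr_tor_factor:
  assumes h: "0 < h" "l \<in> hlat h" and u: "torus_smooth u"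
  shows "torus_smooth (foldr (tor_factor j) rs u) \<and>
    fcoeff h (foldr (tor_factor j) rs u) l = of_real (\<Prod>r\<leftarrow>rs. l $ j / h - real r) * fcoeff h u l"
proof (induction rs)
  case (Cons r rs)
  then show ?case
    by (simp add: torus_smooth_tor_factor fcoeff_tor_factor[OF h] mult.assoc)
qed (use u in simp)

section \<open>Multi-indices of low order and pure powers\<close>

lemma coords: "distinct (coords :: 'n::finite list)" "set (coords :: 'n list) = UNIV"
proof -
  have "\<exists>js :: 'n list. distinct js \<and> set js = UNIV"
    using finite_distinct_list[OF finite[of UNIV]] by auto
  from someI_ex[OF this] show "distinct (coords :: 'n list)" "set (coords :: 'n list) = UNIV"
    unfolding coords_def by auto
qed

lemma diff_op_commute: "diff_op h i (diff_op h j g) = diff_op h j (diff_op h i g)"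
proof
  fix k
  show "diff_op h i (diff_op h j g) k = diff_op h j (diff_op h i g) k"
    unfolding diff_op_def by (simp add: diff_divide_distrib algebra_simps)
qed

lemma diff_op_funpow_commute: "(diff_op h i ^^ p) (diff_op h j g) = diff_op h j ((diff_op h i ^^ p) g)"
  by (induction p) (simp_all add: diff_op_commute[of h i j])

text \<open>The additional factor appears at the position of \<open>j\<close> and is commuted to the
  front. The second branch covers the tails of the enumeration that no longer contain
  \<open>j\<close>.\<close>

lemma foldr_diff_op_update:
  assumes "distinct xs"
  shows "foldr (\<lambda>i. diff_op h i ^^ (\<alpha>(j := Suc (\<alpha> j))) i) xs g =
    (if j \<in> set xs then diff_op h j (foldr (\<lambda>i. diff_op h i ^^ \<alpha> i) xs g)
     else foldr (\<lambda>i. diff_op h i ^^ \<alpha> i) xs g)"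
  using assms by (induction xs) (auto simp: diff_op_funpow_commute)

lemma diff_mop_zero: "diff_mop h (\<lambda>_. 0) g = g"
proof -
  have "foldr (\<lambda>j. diff_op h j ^^ 0) xs g = g" for xs by (induction xs) auto
  then show ?thesis by (simp add: diff_mop_def)
qed

lemma diff_mop_update: "diff_mop h (\<alpha>(j := Suc (\<alpha> j))) g = diff_op h j (diff_mop h \<alpha> g)"
  unfolding diff_mop_def foldr_diff_op_update[OF coords(1)] coords(2) by simp

lemma diff_mop_single: "diff_mop h ((\<lambda>_. 0)(j := Suc 0)) g = diff_op h j g"
  using diff_mop_update[of h "\<lambda>_. 0" j g] by (simp add: diff_mop_zero)

lemma mlen_zero: "mlen (\<lambda>_. 0) = 0"
  by (simp add: mlen_def)

lemma mlen_update: "mlen (\<alpha>(j := Suc (\<alpha> j))) = Suc (mlen \<alpha>)"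
proof -
  have "mlen (\<alpha>(j := Suc (\<alpha> j))) = Suc (\<alpha> j) + (\<Sum>i\<in>UNIV - {j}. \<alpha> i)"
    unfolding mlen_def by (subst sum.remove[of _ j]) (auto intro!: sum.cong)
  also have "\<dots> = Suc (mlen \<alpha>)"
    unfolding mlen_def by (subst (2) sum.remove[of _ j]) auto
  finally show ?thesis .
qed

lemma mlen_single: "mlen ((\<lambda>_. 0)(j := Suc 0)) = 1"
  using mlen_update[of "\<lambda>_. 0" j] by (simp add: mlen_zero)

lemma tor_mop_zero: "tor_mop h (\<lambda>_. 0) u = u"
proof -
  have "foldr (\<lambda>j. foldr (tor_factor j) [0..<0]) xs u = u" for xs by (induction xs) auto
  then show ?thesis by (simp add: tor_mop_def [abs_def] mlen_zero)
qed

lemma tor_mop_single: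
  "tor_mop h ((\<lambda>_. 0)(j := N)) u \<theta> = of_real h ^ N * foldr (tor_factor j) [0..<N] u \<theta>"
proof -
  have "foldr (\<lambda>i. foldr (tor_factor i) [0..<((\<lambda>_. 0)(j := N)) i]) xs u =
    (if j \<in> set xs then foldr (tor_factor j) [0..<N] u else u)" if "distinct xs" for xs
    using that by (induction xs) auto
  moreover have "mlen ((\<lambda>_. 0)(j := N)) = N"
    unfolding mlen_def by (subst sum.remove[of _ j]) auto
  ultimately show ?thesis
    unfolding tor_mop_def using coords[where 'n='a] by simp
qed

text \<open>
  The toroidal derivative of order \<open>N\<close> multiplies the Fourier coefficient at \<open>z\<close> by a falling factorial,
  which vanishes for \<open>0 \<le> z < N\<close>; hence the summand \<open>1\<close> on the right-hand side.
\<close>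

lemma power_le_falling_factorial:
  fixes z :: real
  shows "(1 + \<bar>z\<bar>) ^ N \<le> (4 ^ N + (2 * real N + 2) ^ N) * (1 + \<bar>\<Prod>r\<leftarrow>[0..<N]. z - real r\<bar>)"
proof (cases "2 * real N + 1 \<le> \<bar>z\<bar>")
  \<comment> \<open>For |z| \<ge> 2N + 1 each factor satisfies |z - r| \<ge> |z| - N \<ge> (1 +
    |z|)/4, whence the constant 4^N. For smaller |z| the left-hand side is at most (2N +
    2)^N.\<close>
  case True
  have arith: "(1 + x) / 4 \<le> y" if "s \<le> M" "2 * M + 1 \<le> x" "x - s \<le> y" "0 \<le> M" for s M x y :: real
    using that by (simp add: field_simps)
  have "((1 + \<bar>z\<bar>) / 4) ^ length rs \<le> \<bar>\<Prod>r\<leftarrow>rs. z - real r\<bar>" if "set rs \<subseteq> {..<N}" for rs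
    using that
  proof (induction rs)
    case (Cons r rs)
    have "real r \<le> real N" using Cons.prems by auto
    then have "(1 + \<bar>z\<bar>) / 4 \<le> \<bar>z - real r\<bar>"
      using True abs_triangle_ineq2[of z "real r"] arith[of "real r" "real N" "\<bar>z\<bar>"] by simp
    then have "(1 + \<bar>z\<bar>) / 4 * ((1 + \<bar>z\<bar>) / 4) ^ length rs \<le> \<bar>z - real r\<bar> * \<bar>\<Prod>r\<leftarrow>rs. z - real r\<bar>"
      using Cons by (intro mult_mono) auto
    then show ?case by (simp add: abs_mult)
  qed simp
  from this[of "[0..<N]"] have "((1 + \<bar>z\<bar>) / 4) ^ N \<le> \<bar>\<Prod>r\<leftarrow>[0..<N]. z - real r\<bar>"
    by (simp add: atLeast0LessThan)
  then have "(1 + \<bar>z\<bar>) ^ N \<le> 4 ^ N * \<bar>\<Prod>r\<leftarrow>[0..<N]. z - real r\<bar>"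
    by (simp add: power_divide field_simps)
  also have "\<dots> \<le> (4 ^ N + (2 * real N + 2) ^ N) * (1 + \<bar>\<Prod>r\<leftarrow>[0..<N]. z - real r\<bar>)"
    by (intro mult_mono) auto
  finally show ?thesis .
next
  case False
  then have "(1 + \<bar>z\<bar>) ^ N \<le> (2 * real N + 2) ^ N * 1"
    by (simp add: power_mono)
  also have "\<dots> \<le> (4 ^ N + (2 * real N + 2) ^ N) * (1 + \<bar>\<Prod>r\<leftarrow>[0..<N]. z - real r\<bar>)"
    by (intro mult_mono) auto
  finally show ?thesis .
qed

text \<open>Toroidal derivatives in the direction of the largest coordinate of \<open>l\<close> are
  enough, since |l| is at most n times that coordinate, and dividing by h \<le> 1 only enlarges it.
  The bound \<open>B0\<close> handles the frequencies that the falling factorial annihilates; 1/h^N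
  undoes the factor h^N in \<open>tor_mop\<close>.\<close>

lemma fcoeff_decay:
  fixes u :: "real^'n::finite \<Rightarrow> complex"
  assumes h: "0 < h" "h \<le> 1" and l: "l \<in> hlat h" and u: "torus_smooth u"
    and B0: "\<And>\<theta>. cmod (u \<theta>) \<le> B0"
    and B1: "\<And>j \<theta>. cmod (tor_mop h ((\<lambda>_. 0)(j := N)) u \<theta>) \<le> B1"
  shows "cmod (fcoeff h u l) * (1 + norm l) ^ N
    \<le> real CARD('n) ^ N * (4 ^ N + (2 * real N + 2) ^ N) * (B0 + B1 / h ^ N)"
proof -
  let ?c = "cmod (fcoeff h u l)"
  define A where "A = 4 ^ N + (2 * real N + 2) ^ N"
  obtain j where j: "\<And>i. \<bar>l $ i\<bar> \<le> \<bar>l $ j\<bar>"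
  proof -
    have "Max (range (\<lambda>i. \<bar>l $ i\<bar>)) \<in> range (\<lambda>i. \<bar>l $ i\<bar>)" by (rule Max_in) auto
    then obtain j where "Max (range (\<lambda>i. \<bar>l $ i\<bar>)) = \<bar>l $ j\<bar>" by blast
    then show ?thesis using that[of j] by (metis Max_ge finite finite_imageI rangeI)
  qed
  define z where "z = l $ j / h"
  have "norm l \<le> (\<Sum>i\<in>UNIV. \<bar>l $ i\<bar>)" by (rule norm_le_l1_cart)
  also have "\<dots> \<le> real CARD('n) * \<bar>l $ j\<bar>"
    using sum_mono[of UNIV "\<lambda>i. \<bar>l $ i\<bar>" "\<lambda>_. \<bar>l $ j\<bar>"] j by simp
  also have "\<bar>l $ j\<bar> \<le> \<bar>z\<bar>"
    using h by (simp add: z_def abs_divide le_divide_eq mult_left_le)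
  finally have "norm l \<le> real CARD('n) * \<bar>z\<bar>" by simp
  moreover have "1 \<le> real CARD('n)" by (simp add: Suc_leI)
  ultimately have "1 + norm l \<le> real CARD('n) * (1 + \<bar>z\<bar>)"
    unfolding distrib_left by linarith
  then have "(1 + norm l) ^ N \<le> (real CARD('n) * (1 + \<bar>z\<bar>)) ^ N" by (intro power_mono) auto
  also have "\<dots> \<le> real CARD('n) ^ N * (A * (1 + \<bar>\<Prod>r\<leftarrow>[0..<N]. z - real r\<bar>))"
    unfolding A_def power_mult_distrib by (intro mult_left_mono power_le_falling_factorial) auto
  finally have *: "(1 + norm l) ^ N \<le> real CARD('n) ^ N * (A * (1 + \<bar>\<Prod>r\<leftarrow>[0..<N]. z - real r\<bar>))" .
  have "\<bar>\<Prod>r\<leftarrow>[0..<N]. z - real r\<bar> * ?c = cmod (fcoeff h (foldr (tor_factor j) [0..<N] u) l)"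
    using fcoeff_foldr_tor_factor[OF h(1) l u, of j "[0..<N]"] by (simp add: norm_mult z_def)
  also have "\<dots> \<le> B1 / h ^ N"
  proof (rule norm_fcoeff_le)
    fix \<theta>
    show "cmod (foldr (tor_factor j) [0..<N] u \<theta>) \<le> B1 / h ^ N"
      using B1[of j \<theta>] h by (simp add: tor_mop_single norm_mult norm_power field_simps)
  qed
  finally have prod: "\<bar>\<Prod>r\<leftarrow>[0..<N]. z - real r\<bar> * ?c \<le> B1 / h ^ N" .
  have "?c * (1 + norm l) ^ N \<le> ?c * (real CARD('n) ^ N * (A * (1 + \<bar>\<Prod>r\<leftarrow>[0..<N]. z - real r\<bar>)))"
    by (intro mult_left_mono *) auto
  also have "\<dots> = real CARD('n) ^ N * A * (?c + \<bar>\<Prod>r\<leftarrow>[0..<N]. z - real r\<bar> * ?c)"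
    by (simp add: algebra_simps)
  also have "\<dots> \<le> real CARD('n) ^ N * A * (B0 + B1 / h ^ N)"
    by (intro mult_left_mono add_mono prod norm_fcoeff_le B0) (auto simp: A_def)
  finally show ?thesis by (simp add: A_def)
qed

lemma torus_smooth_diff_op:
  fixes \<sigma> :: "real^'n::finite \<Rightarrow> real^'n \<Rightarrow> complex"
  assumes \<sigma>: "\<And>k. k \<in> hlat h \<Longrightarrow> torus_smooth (\<sigma> k)" and k: "k \<in> hlat h"
  shows "torus_smooth (\<lambda>\<theta>. diff_op h j (\<lambda>k'. \<sigma> k' \<theta>) k)"
    and "fcoeff h (\<lambda>\<theta>. diff_op h j (\<lambda>k'. \<sigma> k' \<theta>) k) l = diff_op h j (\<lambda>k'. fcoeff h (\<sigma> k') l) k"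
proof -
  let ?k' = "k + h *\<^sub>R axis j 1"
  have 1: "torus_smooth (\<sigma> ?k')" "torus_smooth (\<sigma> k)"
    using \<sigma> k hlat_add[OF k hlat_axis] by auto
  have 2: "(\<lambda>\<theta>. diff_op h j (\<lambda>k'. \<sigma> k' \<theta>) k) =
      (\<lambda>\<theta>. (1 / of_real h) * \<sigma> ?k' \<theta> + (- 1 / of_real h) * \<sigma> k \<theta>)"
    by (simp add: diff_op_def diff_divide_distrib)
  show "torus_smooth (\<lambda>\<theta>. diff_op h j (\<lambda>k'. \<sigma> k' \<theta>) k)"
    unfolding 2 by (rule torus_smooth_linear[OF 1])
  show "fcoeff h (\<lambda>\<theta>. diff_op h j (\<lambda>k'. \<sigma> k' \<theta>) k) l = diff_op h j (\<lambda>k'. fcoeff h (\<sigma> k') l) k"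
    unfolding 2 fcoeff_linear[OF 1] by (simp add: diff_op_def diff_divide_distrib)
qed

section \<open>Coefficients of symbols and of their differences\<close>

lemma symbol_classD:
  assumes "\<sigma> \<in> symbol_class h m"
  shows "k \<in> hlat h \<Longrightarrow> torus_smooth (\<sigma> k)"
    and "\<exists>C>0. \<forall>k\<in>hlat h. \<forall>\<theta>. cmod (tor_mop h \<beta> (\<lambda>\<theta>'. diff_mop h \<alpha> (\<lambda>k'. \<sigma> k' \<theta>') k) \<theta>)
          \<le> C * (1 + norm k) powr (m - real (mlen \<alpha>))"
  using assms unfolding symbol_class_def by blast+

text \<open>Only pure powers of one toroidal derivative enter, one for each direction, so summing
  finitely many constants gives a common one. It is applied with differences of order 0, 1 and 2,
  where smoothness follows from linearity.\<close>

lemma symbol_fcoeff_decay_aux: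
  fixes \<sigma> :: "real^'n::finite \<Rightarrow> real^'n \<Rightarrow> complex"
  assumes h: "0 < h" "h \<le> 1" and \<sigma>: "\<sigma> \<in> symbol_class h m"
    and smooth: "\<And>k. k \<in> hlat h \<Longrightarrow> torus_smooth (\<lambda>\<theta>. diff_mop h \<alpha> (\<lambda>k'. \<sigma> k' \<theta>) k)"
  shows "\<exists>C\<ge>0. \<forall>k\<in>hlat h. \<forall>l\<in>hlat h.
    cmod (fcoeff h (\<lambda>\<theta>. diff_mop h \<alpha> (\<lambda>k'. \<sigma> k' \<theta>) k) l) * (1 + norm l) ^ N \<le> C * (1 + norm k) powr (m - real (mlen \<alpha>))"
proof -
  let ?u = "\<lambda>k \<theta>. diff_mop h \<alpha> (\<lambda>k'. \<sigma> k' \<theta>) k" and ?w = "\<lambda>k::real^'n. (1 + norm k) powr (m - real (mlen \<alpha>))"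
  obtain C0 where C0: "0 < C0" "\<And>k \<theta>. k \<in> hlat h \<Longrightarrow> cmod (?u k \<theta>) \<le> C0 * ?w k"
    using symbol_classD(2)[OF \<sigma>, of "\<lambda>_. 0" \<alpha>] unfolding tor_mop_zero by blast
  have "\<forall>j. \<exists>C>0. \<forall>k\<in>hlat h. \<forall>\<theta>. cmod (tor_mop h ((\<lambda>_. 0)(j := N)) (?u k) \<theta>) \<le> C * ?w k"
    using symbol_classD(2)[OF \<sigma>] by blast
  then obtain c where c: "\<And>j. 0 < c j"
      "\<And>j k \<theta>. k \<in> hlat h \<Longrightarrow> cmod (tor_mop h ((\<lambda>_. 0)(j := N)) (?u k) \<theta>) \<le> c j * ?w k"
    by metis
  define C1 where "C1 = (\<Sum>j\<in>UNIV. c j)"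
  have C1: "0 \<le> C1" "c j \<le> C1" for j
    using c(1) unfolding C1_def by (auto intro!: sum_nonneg member_le_sum simp: less_imp_le)
  define A where "A = real CARD('n) ^ N * (4 ^ N + (2 * real N + 2) ^ N)"
  have A: "0 \<le> A" unfolding A_def by simp
  have "cmod (fcoeff h (?u k) l) * (1 + norm l) ^ N \<le> A * (C0 + C1 / h ^ N) * ?w k"
    if k: "k \<in> hlat h" and l: "l \<in> hlat h" for k l
  proof -
    have "cmod (fcoeff h (?u k) l) * (1 + norm l) ^ N \<le> A * (C0 * ?w k + C1 * ?w k / h ^ N)"
      unfolding A_def
    proof (rule fcoeff_decay[OF h l smooth[OF k] C0(2)[OF k]])
      fix j \<theta>
      show "cmod (tor_mop h ((\<lambda>_. 0)(j := N)) (?u k) \<theta>) \<le> C1 * ?w k"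
        using c(2)[OF k, of j \<theta>] mult_right_mono[OF C1(2)[of j], of "?w k"] by simp
    qed
    then show ?thesis by (simp add: algebra_simps)
  qed
  moreover have "0 \<le> A * (C0 + C1 / h ^ N)" using A C0(1) C1(1) h by simp
  ultimately show ?thesis by blast
qed

lemma symbol_fcoeff_decay:
  fixes \<sigma> :: "real^'n::finite \<Rightarrow> real^'n \<Rightarrow> complex"
  assumes h: "0 < h" "h \<le> 1" and \<sigma>: "\<sigma> \<in> symbol_class h m"
  shows "\<exists>C\<ge>0. \<forall>k\<in>hlat h. \<forall>l\<in>hlat h. cmod (fcoeff h (\<sigma> k) l) \<le> C * (1 + norm k) powr m / (1 + norm l) ^ N"
proof -
  have "torus_smooth (\<lambda>\<theta>. diff_mop h (\<lambda>_. 0) (\<lambda>k'. \<sigma> k' \<theta>) k)" if "k \<in> hlat h" for k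
    using symbol_classD(1)[OF \<sigma> that] by (simp add: diff_mop_zero)
  from symbol_fcoeff_decay_aux[OF h \<sigma> this, of N]
  obtain C where "0 \<le> C" and C: "\<And>k l. k \<in> hlat h \<Longrightarrow> l \<in> hlat h \<Longrightarrow>
      cmod (fcoeff h (\<sigma> k) l) * (1 + norm l) ^ N \<le> C * (1 + norm k) powr m"
    by (auto simp: diff_mop_zero mlen_zero)
  moreover have "0 < (1 + norm l) ^ N" for l :: "real^'n" by (simp add: add_pos_nonneg)
  ultimately show ?thesis by (intro exI[of _ C]) (auto simp: pos_le_divide_eq)
qed

text \<open>Taking Fourier coefficients commutes with differences in k. The symbol estimate concerns
  difference quotients; multiplying back by h \<le> 1 keeps the bound.\<close>

lemma symbol_fcoeff_first_difference:
  fixes \<sigma> :: "real^'n::finite \<Rightarrow> real^'n \<Rightarrow> complex"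
  assumes h: "0 < h" "h \<le> 1" and \<sigma>: "\<sigma> \<in> symbol_class h m"
  shows "\<exists>C\<ge>0. \<forall>j. \<forall>k\<in>hlat h. \<forall>l\<in>hlat h.
    cmod (fcoeff h (\<sigma> (k + h *\<^sub>R axis j 1)) l - fcoeff h (\<sigma> k) l) \<le> C * (1 + norm k) powr (m - 1) / (1 + norm l) ^ N"
proof -
  have "\<exists>C\<ge>0. \<forall>k\<in>hlat h. \<forall>l\<in>hlat h.
    cmod (fcoeff h (\<sigma> (k + h *\<^sub>R axis j 1)) l - fcoeff h (\<sigma> k) l) \<le> C * (1 + norm k) powr (m - 1) / (1 + norm l) ^ N" for j
  proof -
    define \<alpha> where "\<alpha> = (\<lambda>_::'n. 0::nat)(j := Suc 0)"
    have dm: "diff_mop h \<alpha> g = diff_op h j g" for g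
      unfolding \<alpha>_def by (rule diff_mop_single)
    have len: "real (mlen \<alpha>) = 1" unfolding \<alpha>_def mlen_single by simp
    note D = torus_smooth_diff_op[where \<sigma>=\<sigma>, OF symbol_classD(1)[OF \<sigma>]]
    have "torus_smooth (\<lambda>\<theta>. diff_mop h \<alpha> (\<lambda>k'. \<sigma> k' \<theta>) k)" if "k \<in> hlat h" for k
      unfolding dm by (rule D(1)[OF _ that])
    from symbol_fcoeff_decay_aux[OF h \<sigma> this, of N]
    obtain C where C0: "0 \<le> C" and C: "\<And>k l. k \<in> hlat h \<Longrightarrow> l \<in> hlat h \<Longrightarrow>
        cmod (diff_op h j (\<lambda>k'. fcoeff h (\<sigma> k') l) k) * (1 + norm l) ^ N \<le> C * (1 + norm k) powr (m - 1)"
      unfolding dm len using D(2) by auto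
    have "cmod (fcoeff h (\<sigma> (k + h *\<^sub>R axis j 1)) l - fcoeff h (\<sigma> k) l) \<le> C * (1 + norm k) powr (m - 1) / (1 + norm l) ^ N"
      if k: "k \<in> hlat h" and l: "l \<in> hlat h" for k l
    proof -
      have p: "0 < (1 + norm l) ^ N" by (simp add: add_pos_nonneg)
      have "cmod (fcoeff h (\<sigma> (k + h *\<^sub>R axis j 1)) l - fcoeff h (\<sigma> k) l)
          = h * cmod (diff_op h j (\<lambda>k'. fcoeff h (\<sigma> k') l) k)"
        using h by (simp add: diff_op_def norm_divide)
      also have "\<dots> \<le> 1 * cmod (diff_op h j (\<lambda>k'. fcoeff h (\<sigma> k') l) k)"
        using h by (intro mult_right_mono) auto
      also have "\<dots> \<le> C * (1 + norm k) powr (m - 1) / (1 + norm l) ^ N"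
        using C[OF k l] p by (simp add: pos_le_divide_eq)
      finally show ?thesis .
    qed
    then show ?thesis using C0 by blast
  qed
  then obtain c where c: "\<And>j. 0 \<le> c j" "\<And>j k l. k \<in> hlat h \<Longrightarrow> l \<in> hlat h \<Longrightarrow>
     cmod (fcoeff h (\<sigma> (k + h *\<^sub>R axis j 1)) l - fcoeff h (\<sigma> k) l) \<le> c j * (1 + norm k) powr (m - 1) / (1 + norm l) ^ N"
    by metis
  have cle: "c j \<le> (\<Sum>j\<in>UNIV. c j)" for j
    by (rule member_le_sum) (use c(1) in auto)
  show ?thesis
  proof (intro exI[of _ "\<Sum>j\<in>UNIV. c j"] conjI allI ballI)
    fix j and k l :: "real^'n" assume "k \<in> hlat h" "l \<in> hlat h"
    from c(2)[OF this, of j]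
    show "cmod (fcoeff h (\<sigma> (k + h *\<^sub>R axis j 1)) l - fcoeff h (\<sigma> k) l) \<le> (\<Sum>j\<in>UNIV. c j) * (1 + norm k) powr (m - 1) / (1 + norm l) ^ N"
      by (rule order_trans) (intro divide_right_mono mult_right_mono cle; simp)
  qed (use c(1) in \<open>simp add: sum_nonneg\<close>)
qed

lemma symbol_fcoeff_second_difference:
  fixes \<sigma> :: "real^'n::finite \<Rightarrow> real^'n \<Rightarrow> complex"
  assumes h: "0 < h" "h \<le> 1" and \<sigma>: "\<sigma> \<in> symbol_class h m"
  shows "\<exists>C\<ge>0. \<forall>i j. \<forall>k\<in>hlat h. \<forall>l\<in>hlat h.
    cmod (fcoeff h (\<sigma> (k + h *\<^sub>R axis i 1 + h *\<^sub>R axis j 1)) l - fcoeff h (\<sigma> (k + h *\<^sub>R axis i 1)) l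
      - (fcoeff h (\<sigma> (k + h *\<^sub>R axis j 1)) l - fcoeff h (\<sigma> k) l)) \<le> C * (1 + norm k) powr (m - 2) / (1 + norm l) ^ N"
proof -
  define d where "d i j k l = fcoeff h (\<sigma> (k + h *\<^sub>R axis i 1 + h *\<^sub>R axis j 1)) l - fcoeff h (\<sigma> (k + h *\<^sub>R axis i 1)) l
      - (fcoeff h (\<sigma> (k + h *\<^sub>R axis j 1)) l - fcoeff h (\<sigma> k) l)" for i j k l
  have "\<exists>C\<ge>0. \<forall>k\<in>hlat h. \<forall>l\<in>hlat h. cmod (d i j k l) \<le> C * (1 + norm k) powr (m - 2) / (1 + norm l) ^ N" for i j
  proof -
    define \<alpha> where "\<alpha> = (\<lambda>_::'n. 0::nat)(j := Suc 0)"
    define \<beta> where "\<beta> = \<alpha>(i := Suc (\<alpha> i))"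
    have dm: "diff_mop h \<beta> g = diff_op h i (diff_op h j g)" for g
      unfolding \<beta>_def diff_mop_update \<alpha>_def diff_mop_single ..
    have len: "real (mlen \<beta>) = 2" unfolding \<beta>_def mlen_update unfolding \<alpha>_def mlen_single by simp
    note D = torus_smooth_diff_op[where \<sigma>=\<sigma>, OF symbol_classD(1)[OF \<sigma>]]
    \<comment> \<open>The first difference of the symbol is again a family of smooth functions on
      the torus, so the same lemma applies to it.\<close>
    note E = torus_smooth_diff_op[where \<sigma>="\<lambda>k \<theta>. diff_op h j (\<lambda>k'. \<sigma> k' \<theta>) k", OF D(1)]
    have "torus_smooth (\<lambda>\<theta>. diff_mop h \<beta> (\<lambda>k'. \<sigma> k' \<theta>) k)" if "k \<in> hlat h" for k
      unfolding dm using E(1)[of h k i] that by simp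
    from symbol_fcoeff_decay_aux[OF h \<sigma> this, of N]
    obtain C where C0: "0 \<le> C" and C: "\<And>k l. k \<in> hlat h \<Longrightarrow> l \<in> hlat h \<Longrightarrow>
        cmod (fcoeff h (\<lambda>\<theta>. diff_op h i (diff_op h j (\<lambda>k'. \<sigma> k' \<theta>)) k) l) * (1 + norm l) ^ N \<le> C * (1 + norm k) powr (m - 2)"
      unfolding dm len by auto
    have "cmod (d i j k l) \<le> C * (1 + norm k) powr (m - 2) / (1 + norm l) ^ N"
      if k: "k \<in> hlat h" and l: "l \<in> hlat h" for k l
    proof -
      have p: "0 < (1 + norm l) ^ N" by (simp add: add_pos_nonneg)
      have k': "k + h *\<^sub>R axis i 1 \<in> hlat h" using hlat_add[OF k hlat_axis] .
      have D2: "fcoeff h (\<lambda>\<theta>. diff_op h j (\<lambda>k'. \<sigma> k' \<theta>) k) l = diff_op h j (\<lambda>k'. fcoeff h (\<sigma> k') l) k"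
        if "k \<in> hlat h" for k
        by (rule D(2)[OF _ that])
      have "fcoeff h (\<lambda>\<theta>. diff_op h i (diff_op h j (\<lambda>k'. \<sigma> k' \<theta>)) k) l
          = diff_op h i (\<lambda>k'. fcoeff h (\<lambda>\<theta>. diff_op h j (\<lambda>k'. \<sigma> k' \<theta>) k') l) k"
        using E(2)[of h k i l] k by simp
      also have "\<dots> = d i j k l / of_real h / of_real h"
        unfolding diff_op_def[of h i] D2[OF k] D2[OF k']
        by (simp add: diff_op_def d_def diff_divide_distrib)
      finally have "cmod (d i j k l) = h * h * cmod (fcoeff h (\<lambda>\<theta>. diff_op h i (diff_op h j (\<lambda>k'. \<sigma> k' \<theta>)) k) l)"
        using h by (simp add: norm_divide norm_mult)
      also have "\<dots> \<le> 1 * cmod (fcoeff h (\<lambda>\<theta>. diff_op h i (diff_op h j (\<lambda>k'. \<sigma> k' \<theta>)) k) l)"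
        using h by (intro mult_right_mono mult_le_one) auto
      also have "\<dots> \<le> C * (1 + norm k) powr (m - 2) / (1 + norm l) ^ N"
        using C[OF k l] p by (simp add: pos_le_divide_eq)
      finally show ?thesis .
    qed
    then show ?thesis using C0 by blast
  qed
  then obtain c where c: "\<And>i j. 0 \<le> c i j" "\<And>i j k l. k \<in> hlat h \<Longrightarrow> l \<in> hlat h \<Longrightarrow>
     cmod (d i j k l) \<le> c i j * (1 + norm k) powr (m - 2) / (1 + norm l) ^ N"
    by metis
  have cle: "c i j \<le> (\<Sum>i\<in>UNIV. \<Sum>j\<in>UNIV. c i j)" for i j
  proof -
    have "c i j \<le> (\<Sum>j\<in>UNIV. c i j)"
      by (rule member_le_sum) (use c(1) in auto)
    also have "\<dots> \<le> (\<Sum>i\<in>UNIV. \<Sum>j\<in>UNIV. c i j)"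
      by (rule member_le_sum) (use c(1) in \<open>auto intro: sum_nonneg\<close>)
    finally show ?thesis .
  qed
  have "\<exists>C\<ge>0. \<forall>i j. \<forall>k\<in>hlat h. \<forall>l\<in>hlat h. cmod (d i j k l) \<le> C * (1 + norm k) powr (m - 2) / (1 + norm l) ^ N"
  proof (intro exI[of _ "\<Sum>i\<in>UNIV. \<Sum>j\<in>UNIV. c i j"] conjI allI ballI)
    fix i j and k l :: "real^'n" assume "k \<in> hlat h" "l \<in> hlat h"
    from c(2)[OF this, of i j]
    show "cmod (d i j k l) \<le> (\<Sum>i\<in>UNIV. \<Sum>j\<in>UNIV. c i j) * (1 + norm k) powr (m - 2) / (1 + norm l) ^ N"
      by (rule order_trans) (intro divide_right_mono mult_right_mono cle; simp)
  qed (use c(1) in \<open>simp add: sum_nonneg\<close>)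
  then show ?thesis unfolding d_def .
qed

subsection \<open>Friedrichs symmetrization\<close>

text \<open>By the inequality of arithmetic and geometric means, a displacement of order (1 +
  |a|)^(1/2) is at most (1 + |a|)/2 plus a constant, so 1 + |k| and 1 + |a| dominate each other.
  Weights can thus be frozen at a on the doubled cube, where the Taylor expansion takes
  place.\<close>

lemma one_plus_norm_powr_comparable:
  fixes a k :: "real^'n::finite"
  assumes "infnorm (k - a) \<le> 2 * sqrt (1 + norm a)"
  shows "(1 + norm k) powr p \<le> (2 + 4 * (real CARD('n))\<^sup>2) powr \<bar>p\<bar> * (1 + norm a) powr p"
proof -
  define n where "n = real CARD('n)"
  define t where "t = sqrt (1 + norm a)"
  define \<kappa> where "\<kappa> = 2 + 4 * n\<^sup>2"
  have n: "1 \<le> n" by (simp add: n_def Suc_leI)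
  have t: "t\<^sup>2 = 1 + norm a" "1 \<le> t" by (auto simp: t_def)
  have nn: "1 \<le> n\<^sup>2" using n by simp
  have "norm (k - a) \<le> n * infnorm (k - a)"
    unfolding n_def by (rule norm_le_card_infnorm)
  also have "\<dots> \<le> n * (2 * t)"
    using assms n by (intro mult_left_mono) (auto simp: t_def)
  finally have d: "norm (k - a) \<le> 2 * (n * t)" by simp
  have q: "4 * (n * t) \<le> t\<^sup>2 + 4 * n\<^sup>2"
    using sum_squares_bound[of t "2 * n"] by (simp add: power_mult_distrib mult_ac)
  have ka: "1 + norm k \<le> \<kappa> * (1 + norm a)"
  proof -
    have "1 + norm k \<le> (1 + norm a) + 2 * (n * t)"
      using d norm_triangle_sub[of k a] by simp
    also have "\<dots> \<le> (1 + norm a) + (1 + norm a) + 4 * n\<^sup>2 * 1"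
      using q unfolding t(1) using nn norm_ge_zero[of a] by linarith
    also have "\<dots> \<le> (1 + norm a) + (1 + norm a) + 4 * n\<^sup>2 * (1 + norm a)"
      by (intro add_mono mult_left_mono) auto
    also have "\<dots> = \<kappa> * (1 + norm a)" by (simp add: \<kappa>_def algebra_simps)
    finally show ?thesis .
  qed
  have ak: "1 + norm a \<le> \<kappa> * (1 + norm k)"
  proof -
    have "1 + norm a \<le> (1 + norm k) + 2 * (n * t)"
      using d norm_triangle_sub[of a k] by (simp add: norm_minus_commute)
    moreover have "x \<le> 2 * y + z" if "x \<le> y + 2 * u" "4 * u \<le> x + z" for x y z u :: real
      using that by simp
    ultimately have "1 + norm a \<le> 2 * (1 + norm k) + 4 * n\<^sup>2 * 1"
      using q unfolding t(1) by simp
    also have "\<dots> \<le> 2 * (1 + norm k) + 4 * n\<^sup>2 * (1 + norm k)"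
      by (intro add_mono mult_left_mono) auto
    also have "\<dots> = \<kappa> * (1 + norm k)" by (simp add: \<kappa>_def algebra_simps)
    finally show ?thesis .
  qed
  have \<kappa>: "0 < \<kappa>" using nn by (simp add: \<kappa>_def)
  have "(1 + norm k) powr p \<le> \<kappa> powr \<bar>p\<bar> * (1 + norm a) powr p"
  proof (cases "0 \<le> p")
    case True
    have "(1 + norm k) powr p \<le> (\<kappa> * (1 + norm a)) powr p"
      using True ka by (intro powr_mono2) auto
    then show ?thesis using True by (simp add: powr_mult)
  next
    case False
    have "(1 + norm a) powr (- p) \<le> (\<kappa> * (1 + norm k)) powr (- p)"
      using False ak by (intro powr_mono2) auto
    then have "(1 + norm a) powr (- p) \<le> \<kappa> powr (- p) * (1 + norm k) powr (- p)"
      by (simp add: powr_mult)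
    moreover have "0 < (1 + norm a) powr p" "0 < (1 + norm k) powr p"
      by (auto simp: add_nonneg_eq_0_iff)
    ultimately have "(1 + norm k) powr p \<le> \<kappa> powr (- p) * (1 + norm a) powr p"
      unfolding powr_minus[of "1 + norm a"] powr_minus[of "1 + norm k"] by (simp add: field_simps)
    then show ?thesis using False by simp
  qed
  then show ?thesis by (simp add: \<kappa>_def n_def)
qed

definition friedrichs :: "real \<Rightarrow> (real^'n::finite \<Rightarrow> real^'n \<Rightarrow> complex) \<Rightarrow> real^'n \<Rightarrow> real^'n \<Rightarrow> complex" where
  "friedrichs h \<sigma> a b = (\<Sum>\<xi>\<in>bump_supp h a. of_real (nbump h a \<xi> * nbump h b \<xi>) * fcoeff h (\<sigma> \<xi>) (b - a))"

text \<open>With w = 1 + |a|, width w^(1/2) and displacement w^(-1/2), all three errors have size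
  w^(m-1): the first-order one is w^(m-1) w^(1/2) w^(-1/2), the second-order one w^(m-2) w, and the
  zeroth-order one w^m w^(-1).\<close>

lemma friedrichs_error:
  fixes \<sigma> :: "real^'n::finite \<Rightarrow> real^'n \<Rightarrow> complex"
  assumes h: "0 < h" "h \<le> 1" and \<sigma>: "\<sigma> \<in> symbol_class h m"
  shows "\<exists>C\<ge>0. \<forall>a\<in>hlat h. \<forall>b\<in>hlat h.
    cmod (fcoeff h (\<sigma> a) (b - a) - friedrichs h \<sigma> a b) \<le> C * (1 + norm a) powr (m - 1) / (1 + norm (b - a)) ^ N"
proof -
  define n where "n = real CARD('n)"
  \<comment> \<open>The power of 1 + |b - a| lost in \<open>nbump_diff_squared_le\<close>; the
    coefficients are taken with that much additional decay.\<close>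
  define K where "K = 2 * CARD('n) + 4"
  define \<kappa> where "\<kappa> = 2 + 4 * n\<^sup>2"
  obtain C0 where C0: "0 \<le> C0" "\<And>k l. k \<in> hlat h \<Longrightarrow> l \<in> hlat h \<Longrightarrow>
      cmod (fcoeff h (\<sigma> k) l) \<le> C0 * (1 + norm k) powr m / (1 + norm l) ^ (N + K)"
    using symbol_fcoeff_decay[OF h \<sigma>, of "N + K"] by blast
  obtain C1 where C1: "0 \<le> C1" "\<And>j k l. k \<in> hlat h \<Longrightarrow> l \<in> hlat h \<Longrightarrow>
      cmod (fcoeff h (\<sigma> (k + h *\<^sub>R axis j 1)) l - fcoeff h (\<sigma> k) l) \<le> C1 * (1 + norm k) powr (m - 1) / (1 + norm l) ^ (N + K)"
    using symbol_fcoeff_first_difference[OF h \<sigma>, of "N + K"] by blast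
  obtain C2 where C2: "0 \<le> C2" "\<And>i j k l. k \<in> hlat h \<Longrightarrow> l \<in> hlat h \<Longrightarrow>
      cmod (fcoeff h (\<sigma> (k + h *\<^sub>R axis i 1 + h *\<^sub>R axis j 1)) l - fcoeff h (\<sigma> (k + h *\<^sub>R axis i 1)) l
      - (fcoeff h (\<sigma> (k + h *\<^sub>R axis j 1)) l - fcoeff h (\<sigma> k) l)) \<le> C2 * (1 + norm k) powr (m - 2) / (1 + norm l) ^ (N + K)"
    using symbol_fcoeff_second_difference[OF h \<sigma>, of "N + K"] by blast
  obtain D where D: "0 \<le> D" "\<And>a b X. a \<in> hlat h \<Longrightarrow> b \<in> hlat h \<Longrightarrow> finite X \<Longrightarrow> bump_supp h a \<subseteq> X \<Longrightarrow> bump_supp h b \<subseteq> X \<Longrightarrow> X \<subseteq> hlat h \<Longrightarrow>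
    (\<Sum>\<xi>\<in>X. (nbump h a \<xi> - nbump h b \<xi>)\<^sup>2) \<le> D * (1 + norm (b - a :: real^'n)) ^ K / (1 + norm a)"
    using nbump_diff_squared_le[OF h, where 'n='n] unfolding K_def by meson
  define G where "G = C1 * \<kappa> powr \<bar>m - 1\<bar> * (n / h) * sqrt D + C2 * \<kappa> powr \<bar>m - 2\<bar> * (n / h)\<^sup>2 / 2 + C0 * D / 2"
  have "cmod (fcoeff h (\<sigma> a) (b - a) - friedrichs h \<sigma> a b) \<le> G * (1 + norm a) powr (m - 1) / (1 + norm (b - a)) ^ N"
    if a: "a \<in> hlat h" and b: "b \<in> hlat h" for a b
  proof -
    define l where "l = b - a"
    define J where "J = 1 + norm l"
    define w where "w = 1 + norm a"
    have l: "l \<in> hlat h" unfolding l_def using hlat_diff[OF b a] .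
    have J: "1 \<le> J" and w: "0 < w" by (auto simp: J_def w_def add_pos_nonneg)
    let ?M1 = "C1 * (\<kappa> powr \<bar>m - 1\<bar> * w powr (m - 1)) / J ^ (N + K)"
    let ?M2 = "C2 * (\<kappa> powr \<bar>m - 2\<bar> * w powr (m - 2)) / J ^ (N + K)"
    let ?M0 = "C0 * w powr m / J ^ (N + K)"
    let ?d = "D * J ^ K / w"
    let ?R = "n * sqrt w / h"
    have cmp: "C * (1 + norm k) powr p / J ^ (N + K) \<le> C * (\<kappa> powr \<bar>p\<bar> * w powr p) / J ^ (N + K)"
      if "0 \<le> C" "infnorm (k - a) \<le> 2 * sqrt (1 + norm a)" for C p k
      using one_plus_norm_powr_comparable[OF that(2), of p] that(1) J
      by (intro divide_right_mono mult_left_mono) (auto simp: \<kappa>_def n_def w_def)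
    have "cmod (fcoeff h (\<sigma> a) l - (\<Sum>\<xi>\<in>bump_supp h a. of_real (nbump h a \<xi> * nbump h b \<xi>) * fcoeff h (\<sigma> \<xi>) l))
      \<le> ?M1 * ?R * sqrt ?d + ?M2 * ?R\<^sup>2 / 2 + ?M0 * ?d / 2"
    proof (rule nbump_average_error[OF h(1) a, where X="bump_supp h a \<union> bump_supp h b", folded n_def w_def])
      fix k i j assume k: "k \<in> hlat h" "infnorm (k - a) \<le> 2 * sqrt w"
      show "cmod (fcoeff h (\<sigma> (k + h *\<^sub>R axis j 1)) l - fcoeff h (\<sigma> k) l) \<le> ?M1"
        using order_trans[OF C1(2)[OF k(1) l, of j, folded J_def] cmp[OF C1(1)]] k(2) unfolding w_def by blast
      show "cmod (fcoeff h (\<sigma> (k + h *\<^sub>R axis i 1 + h *\<^sub>R axis j 1)) l - fcoeff h (\<sigma> (k + h *\<^sub>R axis i 1)) l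
      - (fcoeff h (\<sigma> (k + h *\<^sub>R axis j 1)) l - fcoeff h (\<sigma> k) l)) \<le> ?M2"
        using order_trans[OF C2(2)[OF k(1) l, of i j, folded J_def] cmp[OF C2(1)]] k(2) unfolding w_def by blast
    next
      show "cmod (fcoeff h (\<sigma> a) l) \<le> ?M0"
        using C0(2)[OF a l] by (simp add: J_def w_def)
      have X: "finite (bump_supp h a \<union> bump_supp h b)" "bump_supp h a \<union> bump_supp h b \<subseteq> hlat h"
        using finite_bump_supp[OF h(1)] a b bump_supp_subset by auto
      then show "finite (bump_supp h a \<union> bump_supp h b)" "bump_supp h a \<union> bump_supp h b \<subseteq> hlat h" by auto
      show "(\<Sum>\<xi>\<in>bump_supp h a \<union> bump_supp h b. (nbump h a \<xi> - nbump h b \<xi>)\<^sup>2) \<le> ?d"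
        using D(2)[OF a b X(1) _ _ X(2)] by (simp add: J_def w_def l_def)
      show "0 \<le> ?M1" "0 \<le> ?M2" using C1(1) C2(1) J by auto
    qed (use b in auto)
    also have "?M1 * ?R * sqrt ?d \<le> C1 * \<kappa> powr \<bar>m - 1\<bar> * (n / h) * sqrt D * (w powr (m - 1) / J ^ N)"
    proof -
      have "?M1 * ?R * sqrt ?d = C1 * \<kappa> powr \<bar>m - 1\<bar> * (n / h) * sqrt D * w powr (m - 1) * sqrt (J ^ K) / J ^ (N + K)"
        using w by (simp add: real_sqrt_mult real_sqrt_divide mult_ac)
      also have "\<dots> \<le> C1 * \<kappa> powr \<bar>m - 1\<bar> * (n / h) * sqrt D * w powr (m - 1) * J ^ K / J ^ (N + K)"
      proof (intro divide_right_mono mult_left_mono)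
        show "sqrt (J ^ K) \<le> J ^ K"
          using J one_le_power[OF J, of K] by (intro real_le_lsqrt) (auto simp: power2_eq_square)
      qed (use C1 D h J in \<open>auto simp: n_def\<close>)
      also have "\<dots> = C1 * \<kappa> powr \<bar>m - 1\<bar> * (n / h) * sqrt D * (w powr (m - 1) / J ^ N)"
        using J by (simp add: power_add)
      finally show ?thesis .
    qed
    also have "?M2 * ?R\<^sup>2 / 2 \<le> C2 * \<kappa> powr \<bar>m - 2\<bar> * (n / h)\<^sup>2 / 2 * (w powr (m - 1) / J ^ N)"
    proof -
      have "w powr (m - 2) * w = w powr (m - 1)"
        using w powr_add[of w "m - 2" 1] by simp
      then have "?M2 * ?R\<^sup>2 / 2 = C2 * \<kappa> powr \<bar>m - 2\<bar> * (n / h)\<^sup>2 / 2 * (w powr (m - 1) / J ^ (N + K))"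
        using w by (simp add: power_mult_distrib power_divide mult_ac flip: \<open>w powr (m - 2) * w = w powr (m - 1)\<close>)
      also have "\<dots> \<le> C2 * \<kappa> powr \<bar>m - 2\<bar> * (n / h)\<^sup>2 / 2 * (w powr (m - 1) / J ^ N)"
        using C2(1) J by (intro mult_left_mono divide_left_mono power_increasing) auto
      finally show ?thesis .
    qed
    also have "?M0 * ?d / 2 = C0 * D / 2 * (w powr (m - 1) / J ^ N)"
    proof -
      have "w powr m = w powr (m - 1) * w"
        using w powr_add[of w "m - 1" 1] by simp
      then show ?thesis using w J by (simp add: power_add mult_ac)
    qed
    finally have "cmod (fcoeff h (\<sigma> a) l - (\<Sum>\<xi>\<in>bump_supp h a. of_real (nbump h a \<xi> * nbump h b \<xi>) * fcoeff h (\<sigma> \<xi>) l))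
        \<le> C1 * \<kappa> powr \<bar>m - 1\<bar> * (n / h) * sqrt D * (w powr (m - 1) / J ^ N)
          + C2 * \<kappa> powr \<bar>m - 2\<bar> * (n / h)\<^sup>2 / 2 * (w powr (m - 1) / J ^ N) + C0 * D / 2 * (w powr (m - 1) / J ^ N)"
      by simp
    then have "cmod (fcoeff h (\<sigma> a) l - (\<Sum>\<xi>\<in>bump_supp h a. of_real (nbump h a \<xi> * nbump h b \<xi>) * fcoeff h (\<sigma> \<xi>) l))
        \<le> G * (w powr (m - 1) / J ^ N)"
      unfolding G_def distrib_right .
    then show ?thesis
      unfolding friedrichs_def l_def J_def w_def by simp
  qed
  moreover have "0 \<le> G"
    unfolding G_def using C0 C1 C2 D h by (auto simp: n_def)
  ultimately show ?thesis by blast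
qed

text \<open>The double sum is the integral of u |G|^2 for the trigonometric polynomial G = sum over
  b of \<open>c b * echar h b\<close>. For infinite \<open>F\<close> the sum is 0 by
  convention.\<close>

lemma fcoeff_quadratic_form:
  fixes u :: "real^'n::finite \<Rightarrow> complex"
  assumes u: "torus_smooth u" and pos: "\<And>\<theta>. u \<theta> \<in> \<real>\<^sub>\<ge>\<^sub>0"
  shows "0 \<le> Re (\<Sum>a\<in>F. \<Sum>b\<in>F. fcoeff h u (b - a) * c b * cnj (c a))"
proof (cases "finite F")
  case fin: True
  define G where "G \<theta> = (\<Sum>b\<in>F. c b * echar h b \<theta>)" for \<theta>
  have "((\<lambda>\<theta>. \<Sum>a\<in>F. \<Sum>b\<in>F. (u \<theta> * echar h (b - a) \<theta>) * c b * cnj (c a)) has_integral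
      (\<Sum>a\<in>F. \<Sum>b\<in>F. fcoeff h u (b - a) * c b * cnj (c a))) (cbox 0 1)"
    unfolding fcoeff_def
    by (intro has_integral_sum fin has_integral_mult_left integrable_integral integrable_echar u)
  moreover have "(\<Sum>a\<in>F. \<Sum>b\<in>F. (u \<theta> * echar h (b - a) \<theta>) * c b * cnj (c a)) = u \<theta> * of_real ((cmod (G \<theta>))\<^sup>2)" for \<theta>
  proof -
    have "of_real ((cmod (G \<theta>))\<^sup>2) = cnj (G \<theta>) * G \<theta>"
      by (metis complex_norm_square mult.commute)
    also have "\<dots> = (\<Sum>a\<in>F. \<Sum>b\<in>F. cnj (c a) * echar h (- a) \<theta> * (c b * echar h b \<theta>))"
      unfolding G_def by (simp add: sum_product cnj_echar)
    finally show ?thesis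
      by (simp add: sum_distrib_left mult_ac echar_add[of h b "- a" for b a, simplified])
  qed
  ultimately have "((\<lambda>\<theta>. u \<theta> * of_real ((cmod (G \<theta>))\<^sup>2)) has_integral
      (\<Sum>a\<in>F. \<Sum>b\<in>F. fcoeff h u (b - a) * c b * cnj (c a))) (cbox 0 1)"
    by simp
  from has_integral_linear[OF this bounded_linear_Re]
  have "((\<lambda>\<theta>. Re (u \<theta> * of_real ((cmod (G \<theta>))\<^sup>2))) has_integral
      Re (\<Sum>a\<in>F. \<Sum>b\<in>F. fcoeff h u (b - a) * c b * cnj (c a))) (cbox 0 1)"
    by (simp add: o_def)
  then show ?thesis
  proof (rule has_integral_nonneg)
    fix \<theta>
    have "0 \<le> Re (u \<theta>)" using pos[of \<theta>] by (auto simp: complex_nonneg_Reals_iff)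
    then show "0 \<le> Re (u \<theta> * of_real ((cmod (G \<theta>))\<^sup>2))" by simp
  qed
qed simp

lemma friedrichs_nonneg:
  fixes \<sigma> :: "real^'n::finite \<Rightarrow> real^'n \<Rightarrow> complex"
  assumes h: "0 < h"
    and smooth: "\<And>k. k \<in> hlat h \<Longrightarrow> torus_smooth (\<sigma> k)"
    and pos: "\<And>k \<theta>. k \<in> hlat h \<Longrightarrow> \<sigma> k \<theta> \<in> \<real>\<^sub>\<ge>\<^sub>0"
    and F: "finite F" "F \<subseteq> hlat h"
  shows "0 \<le> Re (\<Sum>a\<in>F. \<Sum>b\<in>F. friedrichs h \<sigma> a b * c b * cnj (c a))"
proof -
  \<comment> \<open>The range of \<xi> in \<open>friedrichs\<close> depends on \<open>a\<close>. A
    common finite range allows the sum over \<xi> to be taken outside, where each \<xi> contributes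
    a form with coefficients \<open>nbump h b \<xi> * c b\<close>.\<close>
  define X where "X = (\<Union>a\<in>F. bump_supp h a)"
  have X: "finite X" "X \<subseteq> hlat h"
    using F finite_bump_supp[OF h] by (auto simp: X_def bump_supp_def)
  have Q: "friedrichs h \<sigma> a b = (\<Sum>\<xi>\<in>X. of_real (nbump h a \<xi> * nbump h b \<xi>) * fcoeff h (\<sigma> \<xi>) (b - a))"
    if "a \<in> F" for a b
    unfolding friedrichs_def
  proof (rule sum.mono_neutral_left)
    show "bump_supp h a \<subseteq> X" using that by (auto simp: X_def)
    show "\<forall>\<xi>\<in>X - bump_supp h a. of_real (nbump h a \<xi> * nbump h b \<xi>) * fcoeff h (\<sigma> \<xi>) (b - a) = 0"
      using X(2) nbump_eq_0[of _ h a] by auto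
  qed (fact X)
  have "(\<Sum>a\<in>F. \<Sum>b\<in>F. friedrichs h \<sigma> a b * c b * cnj (c a)) =
    (\<Sum>a\<in>F. \<Sum>b\<in>F. \<Sum>\<xi>\<in>X. fcoeff h (\<sigma> \<xi>) (b - a) * (of_real (nbump h b \<xi>) * c b) * cnj (of_real (nbump h a \<xi>) * c a))"
    by (intro sum.cong refl) (simp add: Q sum_distrib_right sum_distrib_left mult_ac)
  also have "\<dots> = (\<Sum>\<xi>\<in>X. \<Sum>a\<in>F. \<Sum>b\<in>F. fcoeff h (\<sigma> \<xi>) (b - a) * (of_real (nbump h b \<xi>) * c b) * cnj (of_real (nbump h a \<xi>) * c a))"
    by (subst sum.swap[of _ X], subst sum.swap[of _ X]) (rule refl)
  finally have "Re (\<Sum>a\<in>F. \<Sum>b\<in>F. friedrichs h \<sigma> a b * c b * cnj (c a)) =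
    (\<Sum>\<xi>\<in>X. Re (\<Sum>a\<in>F. \<Sum>b\<in>F. fcoeff h (\<sigma> \<xi>) (b - a) * (of_real (nbump h b \<xi>) * c b) * cnj (of_real (nbump h a \<xi>) * c a)))"
    by simp
  also have "\<dots> \<ge> 0"
  proof (rule sum_nonneg)
    fix \<xi> assume "\<xi> \<in> X"
    then have "\<xi> \<in> hlat h" using X by blast
    then show "0 \<le> Re (\<Sum>a\<in>F. \<Sum>b\<in>F. fcoeff h (\<sigma> \<xi>) (b - a) * (of_real (nbump h b \<xi>) * c b) * cnj (of_real (nbump h a \<xi>) * c a))"
      by (intro fcoeff_quadratic_form smooth pos)
  qed
  finally show ?thesis .
qed

section \<open>The kernel of the operator and the cutoff\<close>

lemma sc_quant_truncated:
  fixes \<sigma> :: "real^'n::finite \<Rightarrow> real^'n \<Rightarrow> complex"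
  assumes F: "finite F" "F \<subseteq> hlat h" and u: "torus_smooth (\<sigma> k)"
  shows "sc_quant h \<sigma> (\<lambda>j. if j \<in> F then f j else 0) k = (\<Sum>j\<in>F. fcoeff h (\<sigma> k) (j - k) * f j)"
proof -
  have fourier: "sc_fourier h (\<lambda>j. if j \<in> F then f j else 0) \<theta> = (\<Sum>j\<in>F. echar h j \<theta> * f j)" for \<theta>
  proof -
    have "sc_fourier h (\<lambda>j. if j \<in> F then f j else 0) \<theta> = (\<Sum>\<^sub>\<infinity>j\<in>F. echar h j \<theta> * f j)"
      unfolding sc_fourier_def echar_def using F by (intro infsum_cong_neutral) auto
    then show ?thesis using F by simp
  qed
  have "((\<lambda>\<theta>. \<Sum>j\<in>F. (\<sigma> k \<theta> * echar h (j - k) \<theta>) * f j) has_integral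
      (\<Sum>j\<in>F. fcoeff h (\<sigma> k) (j - k) * f j)) (cbox 0 1)"
    unfolding fcoeff_def
    by (intro has_integral_sum F has_integral_mult_left integrable_integral integrable_echar u)
  moreover have "exp (2 * of_real pi * \<i> / of_real h * of_real (k \<bullet> \<theta>)) * \<sigma> k \<theta> * sc_fourier h (\<lambda>j. if j \<in> F then f j else 0) \<theta>
      = (\<Sum>j\<in>F. (\<sigma> k \<theta> * echar h (j - k) \<theta>) * f j)" for \<theta>
  proof -
    have "exp (2 * of_real pi * \<i> / of_real h * of_real (k \<bullet> \<theta>)) = echar h (- k) \<theta>"
      by (simp add: echar_def)
    then show ?thesis
      unfolding fourier using echar_add[of h _ "- k" \<theta>]
      by (simp add: sum_distrib_left mult_ac)
  qed
  ultimately show ?thesis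
    unfolding sc_quant_def by (simp add: integral_unique)
qed

definition cutoff :: "real \<Rightarrow> real^'n::finite \<Rightarrow> real" where
  "cutoff R a = max 0 (1 - norm a / R)"

lemma cutoff_bounds: "0 < R \<Longrightarrow> 0 \<le> cutoff R a" "0 < R \<Longrightarrow> cutoff R a \<le> 1"
  by (auto simp: cutoff_def)

lemma cutoff_eq_0: "0 < R \<Longrightarrow> R \<le> norm a \<Longrightarrow> cutoff R a = 0"
  by (simp add: cutoff_def)

text \<open>The Lipschitz constant of the cutoff is 1/R. The leading factor restricts a to |a| < R,
  where 1 + |a| \<le> 2R, so 1/R becomes a gain of one order uniformly in R.\<close>

lemma cutoff_commutator:
  assumes R: "1 \<le> R"
  shows "\<bar>cutoff R a * (cutoff R a - cutoff R b)\<bar> \<le> 2 * (1 + norm (b - a)) / (1 + norm a)"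
proof (cases "R \<le> norm a")
  case True
  then show ?thesis using cutoff_eq_0[of R a] R by (simp add: add_nonneg_pos)
next
  case False
  have "\<bar>cutoff R a - cutoff R b\<bar> \<le> \<bar>norm a / R - norm b / R\<bar>"
    unfolding cutoff_def by linarith
  also have "\<dots> = \<bar>norm a - norm b\<bar> / R"
    using R by (simp add: abs_divide flip: diff_divide_distrib)
  also have "\<dots> \<le> (1 + norm (b - a)) / R"
    using R norm_triangle_ineq3[of a b] by (intro divide_right_mono) (auto simp: norm_minus_commute)
  also have "\<dots> \<le> (1 + norm (b - a)) / ((1 + norm a) / 2)"
    using R False by (intro divide_left_mono) (auto simp: add_pos_nonneg)
  finally have "\<bar>cutoff R a - cutoff R b\<bar> \<le> 2 * (1 + norm (b - a)) / (1 + norm a)" by (simp add: mult.commute)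
  moreover have "\<bar>cutoff R a\<bar> * \<bar>cutoff R a - cutoff R b\<bar> \<le> 1 * \<bar>cutoff R a - cutoff R b\<bar>"
    using cutoff_bounds[of R a] R by (intro mult_right_mono) auto
  ultimately show ?thesis by (simp add: abs_mult)
qed

text \<open>The squared cutoff sits on the a side alone, because it will multiply the terms of the
  series of (P g, g). Positivity needs one cutoff on each side; transferring one of them to b costs
  a commutator. The constant depends neither on \<open>B\<close> nor on \<open>R\<close>.\<close>

lemma garding_truncated:
  fixes \<sigma> :: "real^'n::finite \<Rightarrow> real^'n \<Rightarrow> complex"
  assumes h: "0 < h" "h \<le> 1" and \<sigma>: "\<sigma> \<in> symbol_class h m"
    and pos: "\<And>k \<theta>. k \<in> hlat h \<Longrightarrow> \<sigma> k \<theta> \<in> \<real>\<^sub>\<ge>\<^sub>0"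
  shows "\<exists>C\<ge>0. \<forall>B R g. finite B \<longrightarrow> B \<subseteq> hlat h \<longrightarrow> 1 \<le> R \<longrightarrow>
    - C * (\<Sum>a\<in>B. (1 + norm a) powr (m - 1) * (cmod (g a))\<^sup>2)
    \<le> Re (\<Sum>a\<in>B. \<Sum>b\<in>B. of_real ((cutoff R a)\<^sup>2) * fcoeff h (\<sigma> a) (b - a) * g b * cnj (g a))"
proof -
  obtain N Cs where Cs: "0 \<le> Cs" and schur: "\<And>A B f g. finite A \<Longrightarrow> A \<subseteq> hlat h \<Longrightarrow> finite B \<Longrightarrow> B \<subseteq> hlat h \<Longrightarrow>
    (\<Sum>a\<in>A. \<Sum>b\<in>B. (1 + norm a) powr (m - 1) / (1 + norm (b - a :: real^'n)) ^ N * (cmod (f a) * cmod (g b)))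
      \<le> Cs * ((\<Sum>a\<in>A. (1 + norm a) powr (m - 1) * (cmod (f a))\<^sup>2) + (\<Sum>b\<in>B. (1 + norm b) powr (m - 1) * (cmod (g b))\<^sup>2))"
    using schur_weighted[OF h, where 'n='n and p="m - 1"] by meson
  obtain C1 where C1: "0 \<le> C1" "\<And>a b. a \<in> hlat h \<Longrightarrow> b \<in> hlat h \<Longrightarrow>
    cmod (fcoeff h (\<sigma> a) (b - a) - friedrichs h \<sigma> a b) \<le> C1 * (1 + norm a) powr (m - 1) / (1 + norm (b - a)) ^ N"
    using friedrichs_error[OF h \<sigma>, of N] by blast
  \<comment> \<open>One more power of decay than Schur's test asks for: it pays for the factor 1 +
    |b - a| in the commutator bound.\<close>
  obtain C2 where C2: "0 \<le> C2" "\<And>k l. k \<in> hlat h \<Longrightarrow> l \<in> hlat h \<Longrightarrow>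
      cmod (fcoeff h (\<sigma> k) l) \<le> C2 * (1 + norm k) powr m / (1 + norm l) ^ (N + 1)"
    using symbol_fcoeff_decay[OF h \<sigma>, of "N + 1"] by blast
  define C where "C = (C1 + 2 * C2) * (2 * Cs)"
  have "- C * (\<Sum>a\<in>B. (1 + norm a) powr (m - 1) * (cmod (g a))\<^sup>2)
    \<le> Re (\<Sum>a\<in>B. \<Sum>b\<in>B. of_real ((cutoff R a)\<^sup>2) * fcoeff h (\<sigma> a) (b - a) * g b * cnj (g a))"
    if B: "finite B" "B \<subseteq> hlat h" and R: "1 \<le> R" for B R g
  proof -
    let ?\<chi> = "cutoff R" and ?K = "\<lambda>a b. fcoeff h (\<sigma> a) (b - a)" and ?Q = "friedrichs h \<sigma>"
    \<comment> \<open>With \<chi> the cutoff, \<open>E\<close> is \<chi>(a)^2 K - \<chi>(a) Q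
      \<chi>(b), written as the symmetrization error between two cutoffs plus the commutator
      term.\<close>
    define E where "E a b = of_real (?\<chi> a * ?\<chi> b) * (?K a b - ?Q a b) + of_real (?\<chi> a * (?\<chi> a - ?\<chi> b)) * ?K a b" for a b
    have E: "cmod (E a b) \<le> (C1 + 2 * C2) * ((1 + norm a) powr (m - 1) / (1 + norm (b - a)) ^ N)"
      if a: "a \<in> hlat h" and b: "b \<in> hlat h" for a b
    proof -
      define J where "J = 1 + norm (b - a)"
      define w where "w = 1 + norm a"
      have J: "1 \<le> J" and w: "0 < w" by (auto simp: J_def w_def add_pos_nonneg)
      have "cmod (of_real (?\<chi> a * ?\<chi> b) * (?K a b - ?Q a b)) \<le> 1 * (C1 * w powr (m - 1) / J ^ N)"
        unfolding norm_mult norm_of_real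
      proof (rule mult_mono)
        have "\<bar>?\<chi> c\<bar> \<le> 1" for c :: "real^'n" using cutoff_bounds[of R c] R by simp
        then show "\<bar>?\<chi> a * ?\<chi> b\<bar> \<le> 1"
          unfolding abs_mult by (intro mult_le_one) auto
        show "cmod (?K a b - ?Q a b) \<le> C1 * w powr (m - 1) / J ^ N"
          using C1(2)[OF a b] by (simp add: J_def w_def)
      qed auto
      moreover have "cmod (of_real (?\<chi> a * (?\<chi> a - ?\<chi> b)) * ?K a b) \<le> (2 * J / w) * (C2 * w powr m / J ^ (N + 1))"
        unfolding norm_mult norm_of_real
      proof (rule mult_mono)
        show "\<bar>?\<chi> a * (?\<chi> a - ?\<chi> b)\<bar> \<le> 2 * J / w"
          unfolding J_def w_def by (rule cutoff_commutator[OF R])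
        show "cmod (?K a b) \<le> C2 * w powr m / J ^ (N + 1)"
          using C2(2)[OF a hlat_diff[OF b a]] by (simp add: J_def w_def)
      qed (use J w in auto)
      moreover have "(2 * J / w) * (C2 * w powr m / J ^ (N + 1)) = 2 * C2 * (w powr (m - 1) / J ^ N)"
      proof -
        have "w powr m = w powr (m - 1) * w"
          using w powr_add[of w "m - 1" 1] by simp
        then show ?thesis using w J by simp
      qed
      ultimately have "cmod (E a b) \<le> C1 * w powr (m - 1) / J ^ N + 2 * C2 * (w powr (m - 1) / J ^ N)"
        unfolding E_def by (intro norm_triangle_le add_mono) simp_all
      then show ?thesis by (simp add: J_def w_def distrib_right add_divide_distrib)
    qed
    define S where "S = (\<Sum>a\<in>B. (1 + norm a) powr (m - 1) * (cmod (g a))\<^sup>2)"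
    have "(\<Sum>a\<in>B. \<Sum>b\<in>B. of_real ((?\<chi> a)\<^sup>2) * ?K a b * g b * cnj (g a)) =
      (\<Sum>a\<in>B. \<Sum>b\<in>B. ?Q a b * (of_real (?\<chi> b) * g b) * cnj (of_real (?\<chi> a) * g a)) + (\<Sum>a\<in>B. \<Sum>b\<in>B. E a b * g b * cnj (g a))"
      unfolding sum.distrib[symmetric] E_def
      by (intro sum.cong refl) (simp add: algebra_simps power2_eq_square)
    moreover have "0 \<le> Re (\<Sum>a\<in>B. \<Sum>b\<in>B. ?Q a b * (of_real (?\<chi> b) * g b) * cnj (of_real (?\<chi> a) * g a))"
      by (rule friedrichs_nonneg[OF h(1) symbol_classD(1)[OF \<sigma>] pos B])
    moreover have "cmod (\<Sum>a\<in>B. \<Sum>b\<in>B. E a b * g b * cnj (g a)) \<le> C * S"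
    proof -
      have "cmod (\<Sum>a\<in>B. \<Sum>b\<in>B. E a b * g b * cnj (g a)) \<le>
        (\<Sum>a\<in>B. \<Sum>b\<in>B. (C1 + 2 * C2) * ((1 + norm a) powr (m - 1) / (1 + norm (b - a)) ^ N * (cmod (g a) * cmod (g b))))"
      proof (intro sum_norm_le)
        fix a b assume "a \<in> B" "b \<in> B"
        then have "cmod (E a b) \<le> (C1 + 2 * C2) * ((1 + norm a) powr (m - 1) / (1 + norm (b - a)) ^ N)"
          using E B by blast
        from mult_right_mono[OF this, of "cmod (g a) * cmod (g b)"]
        show "cmod (E a b * g b * cnj (g a)) \<le> (C1 + 2 * C2) * ((1 + norm a) powr (m - 1) / (1 + norm (b - a)) ^ N * (cmod (g a) * cmod (g b)))"
          by (simp add: norm_mult mult_ac)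
      qed
      also have "\<dots> = (C1 + 2 * C2) * (\<Sum>a\<in>B. \<Sum>b\<in>B. (1 + norm a) powr (m - 1) / (1 + norm (b - a)) ^ N * (cmod (g a) * cmod (g b)))"
        by (simp only: sum_distrib_left)
      also have "\<dots> \<le> (C1 + 2 * C2) * (Cs * (S + S))"
        unfolding S_def using C1 C2 by (intro mult_left_mono schur B) auto
      finally show ?thesis by (simp add: C_def)
    qed
    ultimately show ?thesis
      unfolding S_def[symmetric] using complex_Re_le_cmod[of "- (\<Sum>a\<in>B. \<Sum>b\<in>B. E a b * g b * cnj (g a))"] by simp
  qed
  moreover have "0 \<le> C" using Cs C1 C2 by (simp add: C_def)
  ultimately show ?thesis by blast
qed

lemma l2w_norm_squared:
  "(l2w_norm h s g)\<^sup>2 = (\<Sum>\<^sub>\<infinity>k\<in>hlat h. (1 + norm k) powr (2 * s) * (cmod (g k))\<^sup>2)"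
  unfolding l2w_norm_def by (simp add: infsum_nonneg)

lemma sum_le_l2w_norm_squared:
  assumes "g \<in> l2w h (p / 2)" "finite B" "B \<subseteq> hlat h"
  shows "(\<Sum>a\<in>B. (1 + norm a) powr p * (cmod (g a))\<^sup>2) \<le> (l2w_norm h (p / 2) g)\<^sup>2"
  using assms finite_sum_le_infsum[of "\<lambda>k. (1 + norm k) powr p * (cmod (g k))\<^sup>2" "hlat h" B]
  by (simp add: l2w_norm_squared l2w_def)

text \<open>A single row of the kernel decays rapidly, so the weighted Schur test with
  \<open>A = {a}\<close> and the constant function 1 gives absolute convergence against g. Hence the
  limit that defines \<open>sc_Op\<close> exists and is the sum over the row.\<close>

lemma sc_Op_has_sum:
  fixes \<sigma> :: "real^'n::finite \<Rightarrow> real^'n \<Rightarrow> complex"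
  assumes h: "0 < h" "h \<le> 1" and \<sigma>: "\<sigma> \<in> symbol_class h m"
    and g: "g \<in> l2w h ((m - 1) / 2)" and a: "a \<in> hlat h"
  shows "((\<lambda>b. fcoeff h (\<sigma> a) (b - a) * g b) has_sum sc_Op h \<sigma> g a) (hlat h)"
proof -
  let ?K = "\<lambda>b. fcoeff h (\<sigma> a) (b - a)"
  obtain N Cs where Cs: "0 \<le> Cs" and schur: "\<And>A B f g. finite A \<Longrightarrow> A \<subseteq> hlat h \<Longrightarrow> finite B \<Longrightarrow> B \<subseteq> hlat h \<Longrightarrow>
    (\<Sum>a\<in>A. \<Sum>b\<in>B. (1 + norm a) powr (m - 1) / (1 + norm (b - a :: real^'n)) ^ N * (cmod (f a) * cmod (g b)))
      \<le> Cs * ((\<Sum>a\<in>A. (1 + norm a) powr (m - 1) * (cmod (f a))\<^sup>2) + (\<Sum>b\<in>B. (1 + norm b) powr (m - 1) * (cmod (g b))\<^sup>2))"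
    using schur_weighted[OF h, where 'n='n and p="m - 1"] by meson
  obtain C where C: "0 \<le> C" "\<And>k l. k \<in> hlat h \<Longrightarrow> l \<in> hlat h \<Longrightarrow>
      cmod (fcoeff h (\<sigma> k) l) \<le> C * (1 + norm k) powr m / (1 + norm l) ^ N"
    using symbol_fcoeff_decay[OF h \<sigma>, of N] by blast
  define w where "w = 1 + norm a"
  have w: "0 < w" by (auto simp: w_def add_pos_nonneg)
  have pw: "w powr m = w * w powr (m - 1)"
    using w powr_add[of w 1 "m - 1"] by simp
  have "(\<lambda>b. cmod (?K b * g b)) summable_on hlat h"
  proof (rule nonneg_bdd_above_summable_on)
    have "(\<Sum>b\<in>B. cmod (?K b * g b)) \<le> C * w * (Cs * (w powr (m - 1) + (l2w_norm h ((m - 1) / 2) g)\<^sup>2))"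
      if B: "B \<subseteq> hlat h" "finite B" for B
    proof -
      have "(\<Sum>b\<in>B. cmod (?K b * g b)) \<le> (\<Sum>b\<in>B. C * w * (w powr (m - 1) / (1 + norm (b - a)) ^ N * (cmod 1 * cmod (g b))))"
      proof (rule sum_mono)
        fix b assume "b \<in> B"
        then have "b - a \<in> hlat h" using B a hlat_diff by blast
        from mult_right_mono[OF C(2)[OF a this], of "cmod (g b)"]
        show "cmod (?K b * g b) \<le> C * w * (w powr (m - 1) / (1 + norm (b - a)) ^ N * (cmod 1 * cmod (g b)))"
          by (simp add: norm_mult pw flip: w_def)
      qed
      also have "\<dots> = C * w * (\<Sum>b\<in>B. w powr (m - 1) / (1 + norm (b - a)) ^ N * (cmod 1 * cmod (g b)))"
        by (simp only: sum_distrib_left)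
      also have "\<dots> \<le> C * w * (Cs * (w powr (m - 1) + (\<Sum>b\<in>B. (1 + norm b) powr (m - 1) * (cmod (g b))\<^sup>2)))"
        using schur[of "{a}" B "\<lambda>_. 1" g] a B C w by (intro mult_left_mono) (auto simp: w_def)
      also have "\<dots> \<le> C * w * (Cs * (w powr (m - 1) + (l2w_norm h ((m - 1) / 2) g)\<^sup>2))"
        using sum_le_l2w_norm_squared[OF g B(2,1)] C w Cs
        by (intro mult_left_mono add_left_mono) auto
      finally show ?thesis .
    qed
    then show "bdd_above (sum (\<lambda>b. cmod (?K b * g b)) ` {F. F \<subseteq> hlat h \<and> finite F})"
      by (intro bdd_aboveI2) auto
  qed simp
  then have "(\<lambda>b. ?K b * g b) summable_on hlat h"
    by (rule abs_summable_summable)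
  then obtain S where S: "((\<lambda>b. ?K b * g b) has_sum S) (hlat h)"
    by (auto simp: summable_on_def)
  have "((\<lambda>F. sc_quant h \<sigma> (\<lambda>j. if j \<in> F then g j else 0) a) \<longlongrightarrow> S) (finite_subsets_at_top (hlat h))"
  proof (rule Lim_transform_eventually)
    show "((\<lambda>F. \<Sum>b\<in>F. ?K b * g b) \<longlongrightarrow> S) (finite_subsets_at_top (hlat h))"
      using S by (simp add: has_sum_def)
    show "\<forall>\<^sub>F F in finite_subsets_at_top (hlat h). (\<Sum>b\<in>F. ?K b * g b) = sc_quant h \<sigma> (\<lambda>j. if j \<in> F then g j else 0) a"
      by (intro eventually_finite_subsets_at_top_weakI)
         (simp add: sc_quant_truncated symbol_classD(1)[OF \<sigma> a])
  qed
  then have "sc_Op h \<sigma> g a = S"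
    unfolding sc_Op_def by (intro tendsto_Lim) auto
  then show ?thesis using S by simp
qed

subsection \<open>The sharp Garding inequality\<close>

text \<open>The norm enters squared to match homogeneity: replacing g by t g multiplies the
  quadratic form by |t|^2.\<close>

theorem theorem6p13:
  fixes h m :: real
    and \<sigma> :: "real^'n::finite \<Rightarrow> real^'n \<Rightarrow> complex"
    and P :: "(real^'n \<Rightarrow> complex) \<Rightarrow> (real^'n \<Rightarrow> complex)"
  assumes "0 < h" and "h \<le> 1"
    and "\<sigma> \<in> symbol_class h m"
    and "P = sc_Op h \<sigma>"
    and "\<forall>k\<in>hlat h. \<forall>\<theta>. \<sigma> k \<theta> \<in> \<real>\<^sub>\<ge>\<^sub>0"
  shows "\<exists>C::real. \<forall>g\<in>l2w h ((m - 1) / 2).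
           Re (l2_inner h (P g) g) \<ge> - C * (l2w_norm h ((m - 1) / 2) g)\<^sup>2"
proof -
  let ?L = "hlat h :: (real^'n) set"
  let ?K = "\<lambda>a b. fcoeff h (\<sigma> a) (b - a)"
  let ?n2 = "\<lambda>g. (l2w_norm h ((m - 1) / 2) g)\<^sup>2"
  obtain C where C: "0 \<le> C" and garding: "\<And>B R g. finite B \<Longrightarrow> B \<subseteq> ?L \<Longrightarrow> 1 \<le> R \<Longrightarrow>
    - C * (\<Sum>a\<in>B. (1 + norm a) powr (m - 1) * (cmod (g a))\<^sup>2)
    \<le> Re (\<Sum>a\<in>B. \<Sum>b\<in>B. of_real ((cutoff R a)\<^sup>2) * ?K a b * g b * cnj (g a))"
    using garding_truncated[OF assms(1-3)] assms(5) by meson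
  have "Re (l2_inner h (P g) g) \<ge> - C * ?n2 g" if g: "g \<in> l2w h ((m - 1) / 2)" for g
  proof (cases "(\<lambda>a. P g a * cnj (g a)) summable_on ?L")
    \<comment> \<open>A series that is not summable has the value 0 by default, and the lower bound
      is not positive.\<close>
    case False
    then have "l2_inner h (P g) g = 0" unfolding l2_inner_def by (rule infsum_not_exists)
    then show ?thesis using C by simp
  next
    case True
    define x where "x a = P g a * cnj (g a)" for a
    have abs: "(\<lambda>a. cmod (x a)) summable_on ?L"
      using True unfolding x_def by (simp add: summable_on_iff_abs_summable_on_complex)
    have bound: "- C * ?n2 g \<le> Re (\<Sum>\<^sub>\<infinity>a\<in>?L. of_real ((cutoff R a)\<^sup>2) * x a)" if R: "1 \<le> R" for R
    proof -
      define A where "A = {a \<in> ?L. norm a \<le> R}"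
      have "A \<subseteq> {l. l \<in> ?L \<and> infnorm l \<le> R}"
        using infnorm_le_norm order_trans by (auto simp: A_def)
      then have A: "finite A" "A \<subseteq> ?L"
        using hlat_box(1)[OF assms(1), of R] R finite_subset by (auto simp: A_def)
      have A0: "cutoff R a = 0" if "a \<in> ?L" "a \<notin> A" for a
        using that R by (intro cutoff_eq_0) (auto simp: A_def)
      have "((\<lambda>B. \<Sum>a\<in>A. of_real ((cutoff R a)\<^sup>2) * cnj (g a) * (\<Sum>b\<in>B. ?K a b * g b)) \<longlongrightarrow>
          (\<Sum>a\<in>A. of_real ((cutoff R a)\<^sup>2) * cnj (g a) * P g a)) (finite_subsets_at_top ?L)"
        by (intro tendsto_intros) (use sc_Op_has_sum[OF assms(1-3) g] A assms(4) in \<open>auto simp: has_sum_def\<close>)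
      \<comment> \<open>The cutoff leaves finitely many a, while b still runs over the whole lattice
        and is exhausted by finite sets \<open>B\<close>. Once \<open>B\<close> contains
        \<open>A\<close>, summing over a in \<open>B\<close> changes nothing, and the estimate on B
        x B applies.\<close>
      moreover have "\<forall>\<^sub>F B in finite_subsets_at_top ?L.
         - C * ?n2 g \<le> Re (\<Sum>a\<in>A. of_real ((cutoff R a)\<^sup>2) * cnj (g a) * (\<Sum>b\<in>B. ?K a b * g b))"
        unfolding eventually_finite_subsets_at_top
      proof (intro exI[of _ A] conjI A allI impI)
        fix B assume "finite B \<and> A \<subseteq> B \<and> B \<subseteq> ?L"
        then have B: "finite B" "A \<subseteq> B" "B \<subseteq> ?L" by auto
        have "(\<Sum>a\<in>A. of_real ((cutoff R a)\<^sup>2) * cnj (g a) * (\<Sum>b\<in>B. ?K a b * g b)) =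
          (\<Sum>a\<in>B. of_real ((cutoff R a)\<^sup>2) * cnj (g a) * (\<Sum>b\<in>B. ?K a b * g b))"
          by (rule sum.mono_neutral_left) (use A0 B in auto)
        also have "\<dots> = (\<Sum>a\<in>B. \<Sum>b\<in>B. of_real ((cutoff R a)\<^sup>2) * ?K a b * g b * cnj (g a))"
          by (simp add: sum_distrib_left mult_ac)
        also have "Re \<dots> \<ge> - C * (\<Sum>a\<in>B. (1 + norm a) powr (m - 1) * (cmod (g a))\<^sup>2)"
          by (rule garding[OF B(1,3) R])
        moreover have "C * (\<Sum>a\<in>B. (1 + norm a) powr (m - 1) * (cmod (g a))\<^sup>2) \<le> C * ?n2 g"
          using sum_le_l2w_norm_squared[OF g B(1,3)] C by (intro mult_left_mono) auto
        ultimately show "- C * ?n2 g \<le> Re (\<Sum>a\<in>A. of_real ((cutoff R a)\<^sup>2) * cnj (g a) * (\<Sum>b\<in>B. ?K a b * g b))"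
          by simp
      qed
      ultimately have "- C * ?n2 g \<le> Re (\<Sum>a\<in>A. of_real ((cutoff R a)\<^sup>2) * cnj (g a) * P g a)"
        by (intro tendsto_lowerbound[OF tendsto_Re]) auto
      also have "(\<Sum>a\<in>A. of_real ((cutoff R a)\<^sup>2) * cnj (g a) * P g a) = (\<Sum>\<^sub>\<infinity>a\<in>A. of_real ((cutoff R a)\<^sup>2) * x a)"
        using A by (simp add: x_def mult_ac)
      also have "\<dots> = (\<Sum>\<^sub>\<infinity>a\<in>?L. of_real ((cutoff R a)\<^sup>2) * x a)"
        by (rule infsum_cong_neutral) (use A A0 in auto)
      finally show ?thesis .
    qed
    \<comment> \<open>Dominated convergence as R = n tends to infinity: the cutoff is at most 1, so
      |x(a)| is a summable majorant uniformly in n. Its summability is the case assumption, as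
      unconditional and absolute convergence agree for complex series.\<close>
    have unif: "uniform_limit {1..} (\<lambda>B n. \<Sum>a\<in>B. of_real ((cutoff (real n) a)\<^sup>2) * x a)
        (\<lambda>n. \<Sum>\<^sub>\<infinity>a\<in>?L. of_real ((cutoff (real n) a)\<^sup>2) * x a) (finite_subsets_at_top ?L)"
    proof (rule Weierstrass_m_test_general[OF _ abs])
      fix a :: "real^'n" and n :: nat assume "n \<in> {1..}"
      then have "(cutoff (real n) a)\<^sup>2 \<le> 1"
        using cutoff_bounds[of "real n" a] by (simp add: power_le_one)
      from mult_right_mono[OF this, of "cmod (x a)"]
      show "cmod (of_real ((cutoff (real n) a)\<^sup>2) * x a) \<le> cmod (x a)"
        by (simp add: norm_mult norm_power)
    qed
    have cutoff_tendsto: "(\<lambda>n. cutoff (real n) a) \<longlonglongrightarrow> 1" for a :: "real^'n"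
    proof -
      have "(\<lambda>n. max 0 (1 - norm a / real n)) \<longlonglongrightarrow> max 0 (1 - 0)"
        by (intro tendsto_intros tendsto_divide_0[OF tendsto_const] filterlim_at_top_imp_at_infinity filterlim_real_sequentially)
      then show ?thesis by (simp add: cutoff_def)
    qed
    have "(\<lambda>n. \<Sum>\<^sub>\<infinity>a\<in>?L. of_real ((cutoff (real n) a)\<^sup>2) * x a) \<longlonglongrightarrow> (\<Sum>\<^sub>\<infinity>a\<in>?L. x a)"
    proof (rule swap_uniform_limit'[OF _ _ unif])
      show "\<forall>\<^sub>F B in finite_subsets_at_top ?L. (\<lambda>n. \<Sum>a\<in>B. of_real ((cutoff (real n) a)\<^sup>2) * x a) \<longlonglongrightarrow> sum x B"
      proof (intro always_eventually allI)
        fix B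
        have "(\<lambda>n. \<Sum>a\<in>B. of_real ((cutoff (real n) a)\<^sup>2) * x a) \<longlonglongrightarrow> (\<Sum>a\<in>B. of_real (1\<^sup>2) * x a)"
          by (intro tendsto_intros cutoff_tendsto)
        then show "(\<lambda>n. \<Sum>a\<in>B. of_real ((cutoff (real n) a)\<^sup>2) * x a) \<longlonglongrightarrow> sum x B" by simp
      qed
      show "(sum x \<longlongrightarrow> (\<Sum>\<^sub>\<infinity>a\<in>?L. x a)) (finite_subsets_at_top ?L)"
        using True unfolding x_def[symmetric] by (rule infsum_tendsto)
      show "\<forall>\<^sub>F n in sequentially. n \<in> {1..}"
        using eventually_ge_at_top[of "1::nat"] by simp
    qed simp
    moreover have "\<forall>\<^sub>F n in sequentially. - C * ?n2 g \<le> Re (\<Sum>\<^sub>\<infinity>a\<in>?L. of_real ((cutoff (real n) a)\<^sup>2) * x a)"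
      using eventually_ge_at_top[of "1::nat"] by eventually_elim (rule bound, simp)
    ultimately have "- C * ?n2 g \<le> Re (\<Sum>\<^sub>\<infinity>a\<in>?L. x a)"
      by (intro tendsto_lowerbound[OF tendsto_Re]) auto
    then show ?thesis by (simp add: l2_inner_def x_def)
  qed
  then show ?thesis by blast
qed

end
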